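(* There is a universal constant $C>0$ such that the following holds. Let $\varepsilon\ge0$, let $T>0$, and let $\theta$ be a classical solution on $[0,T]\times\mathbb{R}$ of $$\partial_t\theta+H\theta\,\partial_x\theta=\varepsilon\,\partial_{xx}\theta .$$ Assume that $\theta_0=\theta(0,\cdot)$ is a non-negative function in $L^1(\mathbb{R})$. Then $$\|\theta(T,\cdot)\|_{L^\infty}\le C\left(\frac{\|\theta_0\|_{L^1}}{T}\right)^{1/2}.$$
   Context: $H$ is the Hilbert transform in $x$, $H\theta(x)=\frac1\pi\,\mathrm{p.v.}\int_{\mathbb{R}}\frac{\theta(y)}{y-x}\,dy$. A classical solution is a real-valued solution that is $C^{1,\alpha}$ smooth for some $\alpha\in(0,1)$ (and twice differentiable in $x$ if $\varepsilon>0$), decays at infinity in $x$, and satisfies the equation pointwise. The constant $C$ is independent of $\varepsilon$, $T$ and $\theta$. *)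

theory Defs
  imports "HOL-Probability.Probability"
begin

text \<open>Principal value with a possible singularity at x and at infinity: both cut-offs are symmetric
  about x and are removed independently. For integrands that are integrable near infinity this is
  the usual limit of the integrals over |y - x| > d as d tends to 0.\<close>

definition has_pv_integral :: "(real \<Rightarrow> real) \<Rightarrow> real \<Rightarrow> real \<Rightarrow> bool" where
  "has_pv_integral g x I \<longleftrightarrow>
     (\<forall>d R. 0 < d \<longrightarrow> set_integrable lborel {y. d < \<bar>y - x\<bar> \<and> \<bar>y - x\<bar> < R} g) \<and>
     ((\<lambda>(d, R). LBINT y:{y. d < \<bar>y - x\<bar> \<and> \<bar>y - x\<bar> < R}. g y) \<longlongrightarrow> I)
       (at_right 0 \<times>\<^sub>F at_top)"

definition pv_integrable :: "(real \<Rightarrow> real) \<Rightarrow> real \<Rightarrow> bool" where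
  "pv_integrable g x \<longleftrightarrow> (\<exists>I. has_pv_integral g x I)"

definition pv_integral :: "(real \<Rightarrow> real) \<Rightarrow> real \<Rightarrow> real" where
  "pv_integral g x = (THE I. has_pv_integral g x I)"

text \<open>The kernel is 1 / (y - x), the opposite of the more common sign convention.\<close>

definition hilbert :: "(real \<Rightarrow> real) \<Rightarrow> real \<Rightarrow> real" where
  "hilbert f x = 1 / pi * pv_integral (\<lambda>y. f y / (y - x)) x"

text \<open>Functions on [0,T] x R are curried, time first. Their values at times outside [0,T] are
  irrelevant: the time derivative is one-sided at t = 0 and t = T.\<close>

definition time_deriv :: "real \<Rightarrow> (real \<Rightarrow> real \<Rightarrow> real) \<Rightarrow> real \<Rightarrow> real \<Rightarrow> real" where
  "time_deriv T \<theta> t x = vector_derivative (\<lambda>s. \<theta> s x) (at t within {0..T})"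

text \<open>The Hoelder constants may depend on the compact set [0,T] x [-R,R], so that no bound at
  spatial infinity is imposed; in particular the functions with globally Hoelder first
  derivatives are included.\<close>

definition C1_holder :: "real \<Rightarrow> real \<Rightarrow> (real \<Rightarrow> real \<Rightarrow> real) \<Rightarrow> bool" where
  "C1_holder \<alpha> T \<theta> \<longleftrightarrow>
     (\<forall>t\<in>{0..T}. \<forall>x. (\<lambda>s. \<theta> s x) differentiable (at t within {0..T}) \<and>
                     \<theta> t differentiable (at x)) \<and>
     (\<forall>R. \<exists>K. \<forall>t\<in>{0..T}. \<forall>s\<in>{0..T}. \<forall>x\<in>{-R..R}. \<forall>y\<in>{-R..R}.
        \<bar>time_deriv T \<theta> t x - time_deriv T \<theta> s y\<bar> \<le> K * dist (t, x) (s, y) powr \<alpha> \<and>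
        \<bar>deriv (\<theta> t) x - deriv (\<theta> s) y\<bar> \<le> K * dist (t, x) (s, y) powr \<alpha>)"

definition decays_at_infinity :: "real \<Rightarrow> (real \<Rightarrow> real \<Rightarrow> real) \<Rightarrow> bool" where
  "decays_at_infinity T \<theta> \<longleftrightarrow> uniform_limit {0..T} (\<lambda>x t. \<theta> t x) (\<lambda>t. 0) at_infinity"

text \<open>Uniformity in time is automatic when the time derivative is bounded, e.g. if the
  C^{1,alpha} norm on [0,T] x R is finite.\<close>

lemma decays_at_infinity_if_pointwise:
  assumes diff: "\<And>t x. t \<in> {0..T} \<Longrightarrow> (\<lambda>s. \<theta> s x) differentiable (at t within {0..T})"
    and bound: "\<And>t x. t \<in> {0..T} \<Longrightarrow> \<bar>time_deriv T \<theta> t x\<bar> \<le> B"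
    and lim: "\<And>t. t \<in> {0..T} \<Longrightarrow> (\<theta> t \<longlongrightarrow> 0) at_infinity"
  shows "decays_at_infinity T \<theta>"
proof -
  have lip: "\<bar>\<theta> t x - \<theta> s x\<bar> \<le> B * \<bar>t - s\<bar>" if "t \<in> {0..T}" "s \<in> {0..T}" for s t x
  proof -
    have "norm (\<theta> t x - \<theta> s x) \<le> B * norm (t - s)"
    proof (rule field_differentiable_bound[where S = "{0..T}" and f' = "\<lambda>t. time_deriv T \<theta> t x"])
      fix r assume "r \<in> {0..T}"
      then show "((\<lambda>s. \<theta> s x) has_field_derivative time_deriv T \<theta> r x) (at r within {0..T})"
        using diff[of r x] unfolding time_deriv_def has_real_derivative_iff_has_vector_derivative
        by (simp add: vector_derivative_works)
    qed (use bound that in auto)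
    then show ?thesis by simp
  qed
  show ?thesis
    unfolding decays_at_infinity_def uniform_limit_iff
  proof (intro allI impI)
    fix e :: real assume e: "e > 0"
    define b where "b = \<bar>B\<bar> + 1"
    have b: "b > 0" by (simp add: b_def)
    have "{0..T} \<subseteq> (\<Union>t\<in>{0..T}. ball t (e / (2 * b)))" using e b by auto
    then obtain F where F: "F \<subseteq> {0..T}" "finite F"
      and cov: "{0..T} \<subseteq> (\<Union>t\<in>F. ball t (e / (2 * b)))"
      using compactE_image[of "{0..T}" "{0..T}" "\<lambda>t. ball t (e / (2 * b))"]
      by (metis compact_Icc open_ball)
    have "\<forall>t\<in>F. \<forall>\<^sub>F x in at_infinity. \<bar>\<theta> t x\<bar> < e / 2"
    proof
      fix t assume "t \<in> F"
      then have "(\<theta> t \<longlongrightarrow> 0) at_infinity" using F lim by blast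
      then show "\<forall>\<^sub>F x in at_infinity. \<bar>\<theta> t x\<bar> < e / 2"
        using tendstoD[of "\<theta> t" 0 at_infinity "e / 2"] e by (simp only: dist_real_def diff_zero half_gt_zero)
    qed
    then have "\<forall>\<^sub>F x in at_infinity. \<forall>t\<in>F. \<bar>\<theta> t x\<bar> < e / 2"
      using F by (simp add: eventually_ball_finite)
    then show "\<forall>\<^sub>F x in at_infinity. \<forall>t\<in>{0..T}. dist (\<theta> t x) 0 < e"
    proof eventually_elim
      case (elim x)
      show ?case
      proof
        fix t assume t: "t \<in> {0..T}"
        then obtain s where s: "s \<in> F" "\<bar>t - s\<bar> < e / (2 * b)"
          using cov by (force simp: dist_real_def)
        have "\<bar>\<theta> t x - \<theta> s x\<bar> \<le> B * \<bar>t - s\<bar>" using lip t s F by blast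
        also have "\<dots> \<le> b * \<bar>t - s\<bar>" by (rule mult_right_mono) (auto simp: b_def)
        also have "\<dots> < e / 2" using s b by (simp add: field_simps)
        finally have "\<bar>\<theta> t x - \<theta> s x\<bar> < e / 2" .
        moreover have "\<bar>\<theta> s x\<bar> < e / 2" using elim s by blast
        ultimately show "dist (\<theta> t x) 0 < e" unfolding dist_real_def by linarith
      qed
    qed
  qed
qed

text \<open>The existence of the principal value defining the velocity is part of satisfying the equation
  pointwise. For \<open>\<epsilon> = 0\<close> the right-hand side vanishes, whether or not the second derivative exists.\<close>

definition classical_solution :: "real \<Rightarrow> real \<Rightarrow> (real \<Rightarrow> real \<Rightarrow> real) \<Rightarrow> bool" where
  "classical_solution \<epsilon> T \<theta> \<longleftrightarrow>
     (\<exists>\<alpha>. 0 < \<alpha> \<and> \<alpha> < 1 \<and> C1_holder \<alpha> T \<theta>) \<and>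
     (\<epsilon> > 0 \<longrightarrow> (\<forall>t\<in>{0..T}. \<forall>x. deriv (\<theta> t) differentiable (at x))) \<and>
     decays_at_infinity T \<theta> \<and>
     (\<forall>t\<in>{0..T}. \<forall>x.
        pv_integrable (\<lambda>y. \<theta> t y / (y - x)) x \<and>
        time_deriv T \<theta> t x + hilbert (\<theta> t) x * deriv (\<theta> t) x = \<epsilon> * deriv (deriv (\<theta> t)) x)"

end

theory Submission imports Defs begin

text \<open>De Giorgi iteration on the levels of the solution. For a nondecreasing 1-Lipschitz \<open>\<Phi>\<close>
  vanishing below a positive level, \<open>g = \<Phi> \<circ> \<theta> t\<close> has compact support, and integrating the equation
  against \<open>\<Phi>' \<circ> \<theta>\<close> gives, since \<open>H\<theta>\<close> has derivative \<open>-\<Lambda>\<theta>\<close>,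
  \<open>- d/dt \<integral> g \<ge> \<integral> g \<Lambda>\<theta> \<ge> 1/\<pi> \<integral> \<integral> (g(x + z) - g(x))\<^sup>2 / z\<^sup>2 dx dz\<close> with \<open>z > 0\<close>. Keeping only \<open>z < l\<close> and expanding
  the square bounds this below by \<open>2 / (\<pi> l\<^sup>2) (l \<integral> g\<^sup>2 - (\<integral> g)\<^sup>2)\<close> for every \<open>l > 0\<close>. On a time
  interval of length \<open>\<tau>\<close> on which \<open>\<integral> g \<le> M\<close>, the mean value theorem yields a time with
  \<open>\<integral> g\<^sup>2 \<le> 3 M\<^sup>2 / sqrt (\<tau> M)\<close>, and raising the level by \<open>h\<close> leaves mass at most \<open>(2 / h) \<integral> g\<^sup>2\<close>. This
  superlinear gain drives the mass above level \<open>2h\<close> to zero at time \<open>T\<close> once \<open>h\<^sup>2 T\<close> is a large multiple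
  of the initial mass.\<close>

section \<open>Truncated Hilbert transforms\<close>

definition sdiff :: "(real \<Rightarrow> real) \<Rightarrow> real \<Rightarrow> real \<Rightarrow> real" where
  "sdiff f x z = f (x + z) + f (x - z) - 2 * f x"

text \<open>Up to the factor \<open>pi\<close>, this is \<open>hilbert\<close> with the kernel
  restricted to distances between \<open>a\<close> and \<open>b\<close> and folded about
  \<open>x\<close>. For differentiable \<open>f\<close> the folded integrand stays bounded as
  \<open>z\<close> tends to 0.\<close>

definition trunc_hilbert :: "(real \<Rightarrow> real) \<Rightarrow> real \<Rightarrow> real \<Rightarrow> real \<Rightarrow> real" where
  "trunc_hilbert f a b x = integral {a..b} (\<lambda>z. (f (x + z) - f (x - z)) / z)"

text \<open>A truncation of \<open>-pi\<close> times \<open>\<Lambda> f\<close>, the half Laplacian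
  written with second differences.\<close>

definition quad_sdiff :: "(real \<Rightarrow> real) \<Rightarrow> real \<Rightarrow> real \<Rightarrow> real \<Rightarrow> real" where
  "quad_sdiff f a b x = integral {a..b} (\<lambda>z. sdiff f x z / z\<^sup>2)"

lemma integral_shift_line:
  fixes h :: "real \<Rightarrow> real"
  shows "integral {x + a..x + b} h = integral {a..b} (\<lambda>z. h (x + z))"
  using integral_shift_real_ivl[of "x+a" x "x+b" h] by (simp add: add.commute)

lemma integral_reflect_line:
  fixes h :: "real \<Rightarrow> real"
  shows "integral {x - b..x - a} h = integral {a..b} (\<lambda>z. h (x - z))"
proof -
  have "integral {x - b..x - a} h = integral {-b..-a} (\<lambda>z. h (x + z))"
    using integral_shift_line[of x "-b" "-a" h] by simp
  also have "\<dots> = integral {a..b} (\<lambda>z. h (x - z))"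
    using Henstock_Kurzweil_Integration.integral_reflect_real[of b a "\<lambda>z. h (x - z)"] by simp
  finally show ?thesis .
qed

lemma integral_enlarge:
  fixes h :: "real \<Rightarrow> real"
  assumes "\<And>x. x \<notin> {a..b} \<Longrightarrow> h x = 0" "c \<le> a" "b \<le> d"
  shows "integral {c..d} h = integral {a..b} h"
proof (rule integral_spike_set; rule negligible_subset[OF negligible_empty])
qed (use assms in force)+

text \<open>Reflecting the part \<open>y < x\<close> about \<open>x\<close> turns the kernel into
  \<open>-1 / z\<close>, so both sides combine into a single integral over positive
  distances.\<close>

lemma integral_pv_truncation:
  fixes f :: "real \<Rightarrow> real"
  assumes f: "continuous_on UNIV f" and d: "0 < d" "d < R"
    and int: "set_integrable lborel {y. d < \<bar>y - x\<bar> \<and> \<bar>y - x\<bar> < R} (\<lambda>y. f y / (y - x))"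
  shows "(LBINT y:{y. d < \<bar>y - x\<bar> \<and> \<bar>y - x\<bar> < R}. f y / (y - x)) = trunc_hilbert f d R x"
proof -
  let ?h = "\<lambda>y. f y / (y - x)"
  let ?L = "{x - R<..<x - d}" and ?U = "{x + d<..<x + R}"
  have S: "{y. d < \<bar>y - x\<bar> \<and> \<bar>y - x\<bar> < R} = ?L \<union> ?U"
    using d by (auto simp: abs_if)
  have iL: "set_integrable lborel ?L ?h" and iU: "set_integrable lborel ?U ?h"
    using int unfolding S by (rule set_integrable_subset; simp)+
  have cont: "continuous_on {d..R} (\<lambda>z. f (x + z) / z)" "continuous_on {d..R} (\<lambda>z. f (x - z) / z)"
    using d by (auto intro!: continuous_intros continuous_on_compose2[OF f])
  have "(LBINT y:?L \<union> ?U. ?h y) = (LBINT y:?L. ?h y) + (LBINT y:?U. ?h y)"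
    by (rule set_integral_Un[OF _ iL iU]) (use d in auto)
  also have "\<dots> = integral {x - R..x - d} ?h + integral {x + d..x + R} ?h"
    using set_borel_integral_eq_integral(2)[OF iL] set_borel_integral_eq_integral(2)[OF iU]
    by (simp add: integral_open_interval_real)
  also have "\<dots> = integral {d..R} (\<lambda>z. f (x - z) / (- z)) + integral {d..R} (\<lambda>z. f (x + z) / z)"
    by (simp add: integral_reflect_line integral_shift_line)
  also have "\<dots> = integral {d..R} (\<lambda>z. f (x + z) / z) - integral {d..R} (\<lambda>z. f (x - z) / z)"
    by simp
  also have "\<dots> = trunc_hilbert f d R x"
    unfolding trunc_hilbert_def diff_divide_distrib
    by (rule integral_diff[symmetric]) (auto intro!: integrable_continuous_real cont)
  finally show ?thesis unfolding S .
qed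

text \<open>The two-parameter limit is put in sequential form so that dominated convergence can be
  applied along it.\<close>

lemma trunc_hilbert_tendsto:
  assumes f: "continuous_on UNIV f" and pv: "has_pv_integral (\<lambda>y. f y / (y - x)) x I"
    and d: "d \<longlonglongrightarrow> 0" "\<And>n. 0 < d n" "\<And>n. d n < R n" and R: "filterlim R at_top sequentially"
  shows "(\<lambda>n. trunc_hilbert f (d n) (R n) x) \<longlonglongrightarrow> I"
proof -
  let ?A = "\<lambda>(d, R). LBINT y:{y. d < \<bar>y - x\<bar> \<and> \<bar>y - x\<bar> < R}. f y / (y - x)"
  have "filterlim d (at_right 0) sequentially"
    using d(1) by (auto simp: filterlim_at d(2) less_imp_neq[OF d(2), symmetric])
  then have "filterlim (\<lambda>n. (d n, R n)) (at_right 0 \<times>\<^sub>F at_top) sequentially"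
    using R by (rule filterlim_Pair)
  from filterlim_compose[OF conjunct2[OF pv[unfolded has_pv_integral_def]] this]
  have "(\<lambda>n. ?A (d n, R n)) \<longlonglongrightarrow> I" .
  moreover have "?A (d n, R n) = trunc_hilbert f (d n) (R n) x" for n
    using integral_pv_truncation[OF f d(2,3)] pv d(2) unfolding has_pv_integral_def by simp
  ultimately show ?thesis by simp
qed

lemma pi_hilbert_lim:
  assumes f: "continuous_on UNIV f" and pv: "pv_integrable (\<lambda>y. f y / (y - x)) x"
    and d: "d \<longlonglongrightarrow> 0" "\<And>n. 0 < d n" "\<And>n. d n < R n" and R: "filterlim R at_top sequentially"
  shows "(\<lambda>n. trunc_hilbert f (d n) (R n) x) \<longlonglongrightarrow> pi * hilbert f x"
proof -
  obtain I where I: "has_pv_integral (\<lambda>y. f y / (y - x)) x I"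
    using pv by (auto simp: pv_integrable_def)
  note lim = trunc_hilbert_tendsto[OF f _ d R]
  \<comment> \<open>Any two principal values are limits of the same sequence, so the description in
    \<open>pv_integral\<close> is well defined.\<close>
  have "pv_integral (\<lambda>y. f y / (y - x)) x = I"
    unfolding pv_integral_def
  proof (rule the_equality)
    show "J = I" if "has_pv_integral (\<lambda>y. f y / (y - x)) x J" for J
      by (rule LIMSEQ_unique[OF lim[OF that] lim[OF I]])
  qed (rule I)
  with lim[OF I] show ?thesis
    by (simp add: hilbert_def)
qed

section \<open>Truncated transforms of bounded C^1 functions\<close>

locale C1_bounded =
  fixes f f' :: "real \<Rightarrow> real" and B :: real
  assumes deriv_f: "\<And>x. (f has_real_derivative f' x) (at x)"
    and cont_f': "continuous_on UNIV f'"
    and bound_f: "\<And>x. \<bar>f x\<bar> \<le> B"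
begin

lemma cont_f: "continuous_on UNIV f"
  using deriv_f by (meson DERIV_isCont continuous_at_imp_continuous_on)

lemmas cont_comp [continuous_intros] =
  continuous_on_compose2[OF cont_f _ subset_UNIV] continuous_on_compose2[OF cont_f' _ subset_UNIV]

lemma cont_sdiff [continuous_intros]:
  "continuous_on S u \<Longrightarrow> continuous_on S v \<Longrightarrow> continuous_on S (\<lambda>x. sdiff f (u x) (v x))"
  unfolding sdiff_def by (intro continuous_intros)

lemma sdiff_le: "\<bar>sdiff f x z\<bar> \<le> 4 * B"
  using bound_f[of "x + z"] bound_f[of "x - z"] bound_f[of x] unfolding sdiff_def by linarith

lemma DERIV_f [derivative_intros]:
  "(u has_real_derivative u') (at x within S) \<Longrightarrow>
   ((\<lambda>x. f (u x)) has_real_derivative f' (u x) * u') (at x within S)"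
  using DERIV_chain2[OF deriv_f] .

text \<open>Differentiating under the integral produces \<open>f' (x + z) - f' (x - z)\<close>,
  which is the \<open>z\<close>-derivative of \<open>sdiff f x z\<close>. Integration by parts in
  \<open>z\<close> against \<open>1 / z\<close> then trades \<open>f'\<close> for second differences
  of \<open>f\<close> and two boundary terms.\<close>

lemma DERIV_trunc_hilbert:
  assumes ab: "0 < a" "a \<le> b"
  shows "(trunc_hilbert f a b has_real_derivative
           sdiff f x b / b - sdiff f x a / a + quad_sdiff f a b x) (at x)"
proof -
  let ?k = "\<lambda>x z. (f' (x + z) - f' (x - z)) / z"
  have "((\<lambda>x. integral (cbox a b) (\<lambda>z. (f (x + z) - f (x - z)) / z))
      has_field_derivative integral (cbox a b) (?k x)) (at x within UNIV)"
  proof (rule leibniz_rule_field_derivative)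
    show "((\<lambda>x. (f (x + z) - f (x - z)) / z) has_real_derivative ?k y z) (at y within UNIV)"
      if "z \<in> cbox a b" for y z
      by (rule DERIV_cdivide) (auto intro!: derivative_eq_intros)
    show "continuous_on (UNIV \<times> cbox a b) (\<lambda>(x, z). ?k x z)"
      using ab by (auto intro!: continuous_intros simp: split_beta)
    show "(\<lambda>z. (f (y + z) - f (y - z)) / z) integrable_on cbox a b" for y
      unfolding cbox_interval
      by (intro integrable_continuous_real continuous_intros) (use ab in auto)
  qed auto
  moreover have "(?k x has_integral
      sdiff f x b / b - sdiff f x a / a + quad_sdiff f a b x) {a..b}"
  proof -
    have "((\<lambda>z. ?k x z - sdiff f x z / z\<^sup>2) has_integral sdiff f x b / b - sdiff f x a / a) {a..b}"
    proof (rule fundamental_theorem_of_calculus)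
      fix z assume "z \<in> {a..b}"
      then have "z \<noteq> 0" using ab by auto
      have "(sdiff f x has_real_derivative f' (x + z) - f' (x - z)) (at z within {a..b})"
        unfolding sdiff_def by (auto intro!: derivative_eq_intros)
      from DERIV_divide[OF this DERIV_ident \<open>z \<noteq> 0\<close>]
      have "((\<lambda>z. sdiff f x z / z) has_real_derivative ?k x z - sdiff f x z / z\<^sup>2)
          (at z within {a..b})"
        using \<open>z \<noteq> 0\<close> by (simp add: diff_divide_distrib power2_eq_square)
      then show "((\<lambda>z. sdiff f x z / z) has_vector_derivative ?k x z - sdiff f x z / z\<^sup>2)
          (at z within {a..b})"
        by (simp add: has_real_derivative_iff_has_vector_derivative)
    qed (use ab in auto)
    moreover have "((\<lambda>z. sdiff f x z / z\<^sup>2) has_integral quad_sdiff f a b x) {a..b}"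
      unfolding quad_sdiff_def using ab
      by (intro integrable_integral integrable_continuous_real continuous_intros) auto
    ultimately show ?thesis
      by (rule has_integral_add[THEN has_integral_eq_rhs, THEN has_integral_eq[rotated]]) simp_all
  qed
  ultimately show ?thesis
    unfolding trunc_hilbert_def by (simp add: integral_unique)
qed

end

lemma bounded_on_Icc:
  fixes h :: "real \<Rightarrow> real"
  assumes "continuous_on UNIV h"
  obtains K where "0 < K" "\<And>x. x \<in> {a..b} \<Longrightarrow> \<bar>h x\<bar> \<le> K"
proof -
  have "bounded (h ` {a..b})"
    by (intro compact_imp_bounded compact_continuous_image continuous_on_subset[OF assms]) auto
  then show thesis
    using that unfolding bounded_pos by auto
qed

lemma integral_inverse_square:
  assumes "0 < a" "a \<le> b"
  shows "((\<lambda>z::real. c / z\<^sup>2) has_integral c / a - c / b) {a..b}"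
proof -
  have "((\<lambda>z. c / z\<^sup>2) has_integral (- c / b) - (- c / a)) {a..b}"
  proof (rule fundamental_theorem_of_calculus)
    fix z assume "z \<in> {a..b}"
    then have "z \<noteq> 0" using assms by auto
    then have "((\<lambda>z. - c / z) has_real_derivative c / z\<^sup>2) (at z within {a..b})"
      by (auto intro!: derivative_eq_intros simp: power2_eq_square)
    then show "((\<lambda>z. - c / z) has_vector_derivative c / z\<^sup>2) (at z within {a..b})"
      by (simp add: has_real_derivative_iff_has_vector_derivative)
  qed (use assms in auto)
  then show ?thesis by simp
qed

context C1_bounded
begin

lemma B_nonneg: "0 \<le> B"
  using bound_f[of 0] by linarith

lemma diff_le:
  assumes "\<And>y. y \<in> {a..b} \<Longrightarrow> \<bar>f' y\<bar> \<le> K" "x \<in> {a..b}" "y \<in> {a..b}"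
  shows "\<bar>f x - f y\<bar> \<le> K * \<bar>x - y\<bar>"
  using field_differentiable_bound[of "{a..b}" f f' K x y] assms
  by (auto intro: DERIV_subset[OF deriv_f])

lemma quad_sdiff_le:
  assumes "1 \<le> b"
  shows "\<bar>quad_sdiff f 1 b x\<bar> \<le> 4 * B"
proof -
  have "\<bar>quad_sdiff f 1 b x\<bar> \<le> integral {1..b} (\<lambda>z. 4 * B / z\<^sup>2)"
    unfolding quad_sdiff_def real_norm_def[symmetric]
  proof (rule integral_norm_bound_integral)
    show "(\<lambda>z. sdiff f x z / z\<^sup>2) integrable_on {1..b}"
      by (intro integrable_continuous_real continuous_intros) auto
    show "(\<lambda>z. 4 * B / z\<^sup>2) integrable_on {1..b}"
      by (intro integrable_continuous_real continuous_intros) auto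
    show "norm (sdiff f x z / z\<^sup>2) \<le> 4 * B / z\<^sup>2" for z
      using sdiff_le[of x z] by (simp add: divide_right_mono)
  qed
  also have "\<dots> = 4 * B / 1 - 4 * B / b"
    using assms by (intro integral_unique integral_inverse_square) auto
  also have "\<dots> \<le> 4 * B"
    using assms B_nonneg by simp
  finally show ?thesis .
qed

text \<open>Boundedness of \<open>f\<close> alone does not bound the far part uniformly in
  \<open>b\<close>, but it does bound its \<open>x\<close>-derivative: the two boundary terms and
  \<open>quad_sdiff\<close> contribute at most \<open>4 * B\<close> each.\<close>

lemma trunc_hilbert_far_le:
  assumes "1 \<le> b"
  shows "\<bar>trunc_hilbert f 1 b x - trunc_hilbert f 1 b 0\<bar> \<le> 12 * B * \<bar>x\<bar>"
proof -
  have "norm (trunc_hilbert f 1 b x - trunc_hilbert f 1 b 0) \<le> 12 * B * norm (x - 0)"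
  proof (rule field_differentiable_bound[OF convex_UNIV])
    fix y :: real
    show "(trunc_hilbert f 1 b has_real_derivative
        sdiff f y b / b - sdiff f y 1 / 1 + quad_sdiff f 1 b y) (at y within UNIV)"
      using DERIV_trunc_hilbert[of 1 b y] assms by simp
    have "\<bar>sdiff f y b / b\<bar> \<le> \<bar>sdiff f y b\<bar> / 1"
      unfolding abs_divide using assms by (intro divide_left_mono) auto
    then show "norm (sdiff f y b / b - sdiff f y 1 / 1 + quad_sdiff f 1 b y) \<le> 12 * B"
      using sdiff_le[of y b] sdiff_le[of y 1] quad_sdiff_le[OF assms, of y]
      unfolding real_norm_def by linarith
  qed auto
  then show ?thesis by simp
qed

text \<open>The Lipschitz bound cancels the \<open>1 / z\<close>. It is required on a window larger
  than \<open>[-L, L]\<close> by 1 because distances up to 1 occur.\<close>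

lemma trunc_hilbert_near_le:
  assumes a: "0 < a" "a \<le> 1" and x: "\<bar>x\<bar> \<le> L"
    and K: "\<And>y. y \<in> {-L-1..L+1} \<Longrightarrow> \<bar>f' y\<bar> \<le> K"
  shows "\<bar>trunc_hilbert f a 1 x\<bar> \<le> 2 * K"
proof -
  have K0: "0 \<le> K" using K[of 0] x by force
  have "norm (trunc_hilbert f a 1 x) \<le> 2 * K * (1 - a)"
    unfolding trunc_hilbert_def
  proof (rule integral_bound)
    show "continuous_on {a..1} (\<lambda>z. (f (x + z) - f (x - z)) / z)"
      by (intro continuous_intros) (use a in auto)
    fix z assume z: "z \<in> {a..1}"
    have "\<bar>f (x + z) - f (x - z)\<bar> \<le> K * \<bar>(x + z) - (x - z)\<bar>"
      by (rule diff_le[OF K]) (use a x z in auto)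
    then show "norm ((f (x + z) - f (x - z)) / z) \<le> 2 * K"
      using a z by (simp add: abs_mult field_simps)
  qed (use a in auto)
  also have "\<dots> \<le> 2 * K"
    using a K0 by (simp add: mult_left_le)
  finally show ?thesis by simp
qed

lemma trunc_hilbert_split:
  assumes "0 < a" "a \<le> c" "c \<le> b"
  shows "trunc_hilbert f a b x = trunc_hilbert f a c x + trunc_hilbert f c b x"
  unfolding trunc_hilbert_def
  by (rule Henstock_Kurzweil_Integration.integral_combine[symmetric])
    (use assms in \<open>auto intro!: integrable_continuous_real continuous_intros\<close>)

text \<open>The second difference has derivative 0 in \<open>z\<close> at 0, so the inner boundary
  term of \<open>DERIV_trunc_hilbert\<close> disappears in the limit.\<close>

lemma sdiff_div_tendsto:
  assumes d: "d \<longlonglongrightarrow> 0" "\<And>n. d n \<noteq> 0"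
  shows "(\<lambda>n. sdiff f x (d n) / d n) \<longlonglongrightarrow> 0"
proof -
  have "((\<lambda>z. sdiff f x z) has_real_derivative 0) (at 0)"
    unfolding sdiff_def by (auto intro!: derivative_eq_intros)
  then have "((\<lambda>z. sdiff f x z / z) \<longlongrightarrow> 0) (at 0)"
    by (simp add: DERIV_def sdiff_def)
  moreover have "filterlim d (at 0) sequentially"
    using d by (simp add: filterlim_at)
  ultimately show ?thesis
    by (rule filterlim_compose)
qed

lemma sdiff_div_le:
  assumes a: "0 < a" "a \<le> 1" and x: "\<bar>x\<bar> \<le> L"
    and K: "\<And>y. y \<in> {-L-1..L+1} \<Longrightarrow> \<bar>f' y\<bar> \<le> K"
  shows "\<bar>sdiff f x a / a\<bar> \<le> 2 * K"
proof -
  have "\<bar>f (x + a) - f x\<bar> \<le> K * \<bar>(x + a) - x\<bar>"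
    by (rule diff_le[OF K]) (use a x in auto)
  moreover have "\<bar>f (x - a) - f x\<bar> \<le> K * \<bar>(x - a) - x\<bar>"
    by (rule diff_le[OF K]) (use a x in auto)
  ultimately have "\<bar>sdiff f x a\<bar> \<le> 2 * K * a"
    using a unfolding sdiff_def by simp
  then show ?thesis
    using a by (simp add: field_simps)
qed

end

section \<open>Dissipation of a compactly supported truncation\<close>

locale C1_truncation = C1_bounded +
  fixes \<Phi> \<phi> :: "real \<Rightarrow> real" and L :: real
  assumes deriv_\<Phi>: "\<And>s. (\<Phi> has_real_derivative \<phi> s) (at s)"
    and cont_\<phi>: "continuous_on UNIV \<phi>"
    and \<phi>_bounds: "\<And>s. 0 \<le> \<phi> s" "\<And>s. \<phi> s \<le> 1"
    and \<Phi>_nonneg: "\<And>s. 0 \<le> \<Phi> s"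
    and L_nonneg: "0 \<le> L"
    and \<Phi>_outside: "\<And>x. L \<le> \<bar>x\<bar> \<Longrightarrow> \<Phi> (f x) = 0"
begin

definition g where "g x = \<Phi> (f x)"
definition g' where "g' x = \<phi> (f x) * f' x"

lemma g_nonneg: "0 \<le> g x" by (simp add: g_def \<Phi>_nonneg)

lemma g_outside: "L \<le> \<bar>x\<bar> \<Longrightarrow> g x = 0" by (simp add: g_def \<Phi>_outside)

lemma deriv_g: "(g has_real_derivative g' x) (at x)"
  unfolding g_def[abs_def] g'_def by (rule DERIV_chain2[OF deriv_\<Phi> deriv_f])

lemma cont_g: "continuous_on UNIV g"
  using deriv_g by (meson DERIV_isCont continuous_at_imp_continuous_on)

lemma cont_g': "continuous_on UNIV g'"
  unfolding g'_def by (intro continuous_intros continuous_on_compose2[OF cont_\<phi> cont_f] cont_f') auto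

lemmas cont_g_comp [continuous_intros] =
  continuous_on_compose2[OF cont_g _ subset_UNIV] continuous_on_compose2[OF cont_g' _ subset_UNIV]

text \<open>Since \<open>\<phi>\<close> takes values in \<open>[0, 1]\<close>, an increment of
  \<open>g\<close> has the sign of the increment of \<open>f\<close> and at most its size. This
  bounds the mixed form of \<open>g\<close> and \<open>f\<close> below by the quadratic form of
  \<open>g\<close>.\<close>

lemma g_diff_le: "(g x - g y)\<^sup>2 \<le> (g x - g y) * (f x - f y)"
proof -
  have *: "(\<Phi> b - \<Phi> a)\<^sup>2 \<le> (\<Phi> b - \<Phi> a) * (b - a)" if ab: "a < b" for a b
  proof -
    obtain s where "\<Phi> b - \<Phi> a = (b - a) * \<phi> s"
      using MVT2[OF ab, of \<Phi> \<phi>] deriv_\<Phi> by blast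
    then have "0 \<le> \<Phi> b - \<Phi> a" "\<Phi> b - \<Phi> a \<le> b - a"
      using ab \<phi>_bounds[of s] by (simp_all add: mult_left_le)
    then show ?thesis
      by (simp add: power2_eq_square mult_left_mono)
  qed
  show ?thesis
    using *[of "f x" "f y"] *[of "f y" "f x"] unfolding g_def
    by (cases "f x" "f y" rule: linorder_cases) (auto simp: power2_eq_square algebra_simps)
qed

text \<open>A discrete integration by parts: the backward difference is translated by
  \<open>z\<close>. The interval \<open>[-L - z, L]\<close> contains the supports of both
  \<open>g\<close> and its translate.\<close>

lemma integral_g_sdiff:
  assumes z: "0 \<le> z"
  shows "- integral {-L..L} (\<lambda>x. g x * sdiff f x z) =
    integral {-L-z..L} (\<lambda>x. (g (x + z) - g x) * (f (x + z) - f x))"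
proof -
  have "integral {-L..L} (\<lambda>x. g x * (f x - f (x - z)))
      = integral {-L-z..L-z} (\<lambda>x. g (x + z) * (f (x + z) - f x))"
    using integral_shift_real_ivl[of "-L" z L "\<lambda>x. g x * (f x - f (x - z))"] by simp
  also have "\<dots> = integral {-L-z..L} (\<lambda>x. g (x + z) * (f (x + z) - f x))"
    by (rule integral_enlarge[symmetric]) (use z g_outside in auto)
  finally have 1: "integral {-L..L} (\<lambda>x. g x * (f x - f (x - z)))
      = integral {-L-z..L} (\<lambda>x. g (x + z) * (f (x + z) - f x))" .
  have 2: "integral {-L..L} (\<lambda>x. g x * (f x - f (x + z)))
      = integral {-L-z..L} (\<lambda>x. g x * (f x - f (x + z)))"
    by (rule integral_enlarge[symmetric]) (use z g_outside in auto)
  have "- integral {-L..L} (\<lambda>x. g x * sdiff f x z)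
      = integral {-L..L} (\<lambda>x. g x * (f x - f (x - z)) + g x * (f x - f (x + z)))"
    unfolding integral_neg[symmetric] by (simp add: sdiff_def algebra_simps)
  also have "\<dots> = integral {-L..L} (\<lambda>x. g x * (f x - f (x - z)))
      + integral {-L..L} (\<lambda>x. g x * (f x - f (x + z)))"
    by (intro integral_add integrable_continuous_real continuous_intros)
  also have "\<dots> = integral {-L-z..L}
      (\<lambda>x. g (x + z) * (f (x + z) - f x) + g x * (f x - f (x + z)))"
    unfolding 1 2 by (intro integral_add[symmetric] integrable_continuous_real continuous_intros)
  also have "\<dots> = integral {-L-z..L} (\<lambda>x. (g (x + z) - g x) * (f (x + z) - f x))"
    by (simp add: algebra_simps)
  finally show ?thesis .
qed

lemma integral_g_sdiff_nonneg:
  assumes "0 \<le> z"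
  shows "0 \<le> - integral {-L..L} (\<lambda>x. g x * sdiff f x z)"
  unfolding integral_g_sdiff[OF assms]
proof (rule integral_nonneg)
  show "(\<lambda>x. (g (x + z) - g x) * (f (x + z) - f x)) integrable_on {- L - z..L}"
    by (intro integrable_continuous_real continuous_intros)
  show "0 \<le> (g (x + z) - g x) * (f (x + z) - f x)" for x
    using order_trans[OF zero_le_power2 g_diff_le] .
qed

text \<open>After \<open>g_diff_le\<close> replaces \<open>f\<close> by \<open>g\<close>, the square
  is expanded; its two pure squares have equal integrals by translation invariance.\<close>

lemma integral_g_sdiff_ge:
  assumes z: "0 \<le> z"
  shows "2 * integral {-L..L} (\<lambda>x. (g x)\<^sup>2) - 2 * integral {-L..L} (\<lambda>x. g x * g (x + z))
    \<le> - integral {-L..L} (\<lambda>x. g x * sdiff f x z)"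
proof -
  have "integral {-L-z..L-z} (\<lambda>x. (g (x + z))\<^sup>2) = integral {-L..L} (\<lambda>x. (g x)\<^sup>2)"
    using integral_shift_real_ivl[of "-L" z L "\<lambda>x. (g x)\<^sup>2"] by simp
  moreover have "integral {-L-z..L} (\<lambda>x. (g (x + z))\<^sup>2) = integral {-L-z..L-z} (\<lambda>x. (g (x + z))\<^sup>2)"
    by (rule integral_enlarge) (use z g_outside in auto)
  moreover have "integral {-L-z..L} (\<lambda>x. (g x)\<^sup>2) = integral {-L..L} (\<lambda>x. (g x)\<^sup>2)"
    by (rule integral_enlarge) (use z g_outside in auto)
  moreover have "integral {-L-z..L} (\<lambda>x. g x * g (x + z)) = integral {-L..L} (\<lambda>x. g x * g (x + z))"
    by (rule integral_enlarge) (use z g_outside in auto)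
  moreover have "integral {-L-z..L} (\<lambda>x. (g (x + z))\<^sup>2 + (g x)\<^sup>2 - 2 * (g x * g (x + z)))
     = integral {-L-z..L} (\<lambda>x. (g (x + z))\<^sup>2) + integral {-L-z..L} (\<lambda>x. (g x)\<^sup>2)
        - 2 * integral {-L-z..L} (\<lambda>x. g x * g (x + z))"
    by (subst integral_diff integral_add integral_mult_right;
      (intro integrable_continuous_real continuous_intros)?)+ simp
  ultimately have "2 * integral {-L..L} (\<lambda>x. (g x)\<^sup>2) - 2 * integral {-L..L} (\<lambda>x. g x * g (x + z))
     = integral {-L-z..L} (\<lambda>x. (g (x + z))\<^sup>2 + (g x)\<^sup>2 - 2 * (g x * g (x + z)))"
    by simp
  also have "\<dots> = integral {-L-z..L} (\<lambda>x. (g (x + z) - g x)\<^sup>2)"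
    by (simp add: power2_diff mult.commute mult.left_commute)
  also have "\<dots> \<le> integral {-L-z..L} (\<lambda>x. (g (x + z) - g x) * (f (x + z) - f x))"
    by (intro integral_le integrable_continuous_real continuous_intros g_diff_le)
  finally show ?thesis
    unfolding integral_g_sdiff[OF z] .
qed

lemma integral_g_le: "integral {a..b} g \<le> integral {-L..L} g"
proof -
  have "integral {a..b} g \<le> integral {min a (-L)..max b L} g"
    by (intro integral_subset_le integrable_continuous_real continuous_intros) (auto simp: g_nonneg)
  also have "\<dots> = integral {-L..L} g"
    by (rule integral_enlarge) (use g_outside in auto)
  finally show ?thesis .
qed

text \<open>With the order of integration exchanged, the inner integral of \<open>g (x + z)\<close>
  over \<open>z\<close> is at most the whole mass of \<open>g\<close>.\<close>

lemma integral_autocorrelation_le: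
  "integral {a..b} (\<lambda>z. integral {-L..L} (\<lambda>x. g x * g (x + z))) \<le> (integral {-L..L} g)\<^sup>2"
proof -
  have "integral {a..b} (\<lambda>z. integral {-L..L} (\<lambda>x. g x * g (x + z)))
      = integral {-L..L} (\<lambda>x. integral {a..b} (\<lambda>z. g x * g (x + z)))"
    unfolding cbox_interval[symmetric]
    by (rule integral_swap_continuous) (auto simp: split_beta intro!: continuous_intros)
  also have "\<dots> \<le> integral {-L..L} (\<lambda>x. g x * integral {-L..L} g)"
  proof (rule integral_le)
    show "(\<lambda>x. integral {a..b} (\<lambda>z. g x * g (x + z))) integrable_on {-L..L}"
      unfolding cbox_interval[symmetric]
      by (intro integrable_continuous integral_continuous_on_param)
        (auto simp: split_beta intro!: continuous_intros)
    show "(\<lambda>x. g x * integral {-L..L} g) integrable_on {-L..L}"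
      by (intro integrable_continuous_real continuous_intros)
    show "integral {a..b} (\<lambda>z. g x * g (x + z)) \<le> g x * integral {-L..L} g" for x
      using integral_g_le[of "x + a" "x + b"]
      by (simp add: integral_shift_line mult_left_mono g_nonneg)
  qed
  also have "\<dots> = (integral {-L..L} g)\<^sup>2"
    by (simp add: power2_eq_square)
  finally show ?thesis .
qed

text \<open>Exchanging the integrals gives the integral of \<open>q z / z\<^sup>2\<close> with
  \<open>q\<close> nonnegative. The lower bound keeps only distances in \<open>[d, d + l]\<close>,
  where the weight is at least \<open>1 / (d + l)\<^sup>2\<close>.\<close>

lemma dissipation_ge:
  assumes d: "0 < d" "0 < l" "d + l \<le> R"
  shows "(2 * l * integral {-L..L} (\<lambda>x. (g x)\<^sup>2) - 2 * (integral {-L..L} g)\<^sup>2) / (d + l)\<^sup>2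
     \<le> - integral {-L..L} (\<lambda>x. g x * quad_sdiff f d R x)" (is ?lower)
    and "0 \<le> - integral {-L..L} (\<lambda>x. g x * quad_sdiff f d R x)" (is ?nonneg)
proof -
  define q where "q z = - integral {-L..L} (\<lambda>x. g x * sdiff f x z)" for z
  define G where "G = integral {-L..L} (\<lambda>x. (g x)\<^sup>2)"
  define c where "c z = integral {-L..L} (\<lambda>x. g x * g (x + z))" for z
  have q_nonneg: "0 \<le> q z" if "0 \<le> z" for z
    using integral_g_sdiff_nonneg[OF that] by (simp add: q_def)
  have cont_q: "continuous_on S q" for S
    unfolding q_def[abs_def] cbox_interval[symmetric]
    by (intro continuous_on_minus integral_continuous_on_param)
      (auto simp: split_beta intro!: continuous_intros)
  have cont_c: "continuous_on S c" for S
    unfolding c_def[abs_def] cbox_interval[symmetric]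
    by (intro integral_continuous_on_param) (auto simp: split_beta intro!: continuous_intros)
  have int_q: "(\<lambda>z. q z / z\<^sup>2) integrable_on {a..b}" if "0 < a" for a b
    by (intro integrable_continuous_real continuous_intros cont_q) (use that in auto)
  have "integral {-L..L} (\<lambda>x. g x * quad_sdiff f d R x)
      = integral {-L..L} (\<lambda>x. integral {d..R} (\<lambda>z. g x * (sdiff f x z / z\<^sup>2)))"
    by (simp add: quad_sdiff_def del: times_divide_eq_right)
  also have "\<dots> = integral {d..R} (\<lambda>z. integral {-L..L} (\<lambda>x. g x * (sdiff f x z / z\<^sup>2)))"
    unfolding cbox_interval[symmetric]
  proof (rule integral_swap_continuous)
    show "continuous_on (cbox (- L, d) (L, R)) (\<lambda>(x, z). g x * (sdiff f x z / z\<^sup>2))"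
      unfolding split_beta by (intro continuous_intros) (use d in \<open>auto simp: cbox_Pair_eq\<close>)
  qed
  also have "\<dots> = - integral {d..R} (\<lambda>z. q z / z\<^sup>2)"
    by (simp add: q_def)
  finally have eq: "- integral {-L..L} (\<lambda>x. g x * quad_sdiff f d R x)
      = integral {d..R} (\<lambda>z. q z / z\<^sup>2)" by simp
  show ?nonneg
    unfolding eq using d by (intro integral_nonneg int_q) (auto simp: q_nonneg)
  have "(2 * l * G - 2 * (integral {-L..L} g)\<^sup>2) / (d + l)\<^sup>2
      \<le> (2 * l * G - 2 * integral {d..d+l} c) / (d + l)\<^sup>2"
    using integral_autocorrelation_le[of d "d + l"]
    by (intro divide_right_mono) (auto simp: c_def[abs_def])
  also have "2 * l * G - 2 * integral {d..d+l} c = integral {d..d+l} (\<lambda>z. 2 * G - 2 * c z)"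
    using d by (subst integral_diff) (auto intro!: integrable_continuous_real continuous_intros cont_c)
  also have "\<dots> / (d + l)\<^sup>2 = integral {d..d+l} (\<lambda>z. (2 * G - 2 * c z) / (d + l)\<^sup>2)"
    by simp
  also have "\<dots> \<le> integral {d..d+l} (\<lambda>z. q z / z\<^sup>2)"
  proof (rule integral_le)
    show "(\<lambda>z. (2 * G - 2 * c z) / (d + l)\<^sup>2) integrable_on {d..d + l}"
      by (intro integrable_continuous_real continuous_intros cont_c) (use d in auto)
    fix z assume z: "z \<in> {d..d + l}"
    \<comment> \<open>The denominator is shrunk only after passing to \<open>q z\<close>, whose sign
      is known.\<close>
    have "2 * G - 2 * c z \<le> q z"
      using integral_g_sdiff_ge[of z] z d by (simp add: G_def c_def q_def)
    then have "(2 * G - 2 * c z) / (d + l)\<^sup>2 \<le> q z / (d + l)\<^sup>2"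
      by (rule divide_right_mono) auto
    also have "\<dots> \<le> q z / z\<^sup>2"
      using z d q_nonneg[of z] by (intro divide_left_mono power_mono) auto
    finally show "(2 * G - 2 * c z) / (d + l)\<^sup>2 \<le> q z / z\<^sup>2" .
  qed (use d int_q in auto)
  also have "\<dots> \<le> integral {d..R} (\<lambda>z. q z / z\<^sup>2)"
    using d by (intro integral_subset_le int_q) (auto simp: q_nonneg)
  finally show ?lower
    unfolding eq G_def .
qed

text \<open>The velocity need not be integrable against \<open>g'\<close> a priori: dominated convergence along
  symmetric truncations gives integrability together with the dissipation bound.\<close>

lemma hilbert_flux:
  assumes pv: "\<And>x. pv_integrable (\<lambda>y. f y / (y - x)) x"
  shows hilbert_flux_integrable: "(\<lambda>x. hilbert f x * g' x) integrable_on {-L..L}"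
    and hilbert_flux_nonneg: "0 \<le> integral {-L..L} (\<lambda>x. hilbert f x * g' x)"
    and hilbert_flux_ge: "0 < l \<Longrightarrow>
      2 * (l * integral {-L..L} (\<lambda>x. (g x)\<^sup>2) - (integral {-L..L} g)\<^sup>2) / (pi * l\<^sup>2)
        \<le> integral {-L..L} (\<lambda>x. hilbert f x * g' x)"
proof -
  \<comment> \<open>The shift by 2 ensures \<open>d n < 1 < R n\<close>, so every truncation splits
    at distance 1.\<close>
  define d where "d n = 1 / real (n + 2)" for n
  define R where "R n = real (n + 2)" for n
  have d_pos: "0 < d n" and d_le: "d n \<le> 1" and R_ge: "1 \<le> R n" for n
    by (auto simp: d_def R_def)
  have d_less: "d n < R n" for n
  proof -
    have "d n < 1" by (simp add: d_def)
    then show ?thesis using R_ge[of n] by linarith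
  qed
  have d_lim: "d \<longlonglongrightarrow> 0"
    unfolding d_def[abs_def]
    using LIMSEQ_ignore_initial_segment[OF lim_const_over_n[of "1::real"], of 2] by simp
  have R_lim: "filterlim R at_top sequentially"
    unfolding R_def[abs_def]
    using filterlim_compose[OF filterlim_real_sequentially filterlim_add_const_nat_at_top] .
  note H_lim = pi_hilbert_lim[OF cont_f pv d_lim d_pos d_less R_lim]
  obtain K where K: "0 < K" "\<And>y. y \<in> {-L-1..L+1} \<Longrightarrow> \<bar>f' y\<bar> \<le> K"
    using bounded_on_Icc[OF cont_f'] by blast
  obtain K' where K': "0 < K'" "\<And>y. y \<in> {-L..L} \<Longrightarrow> \<bar>g' y\<bar> \<le> K'"
    using bounded_on_Icc[OF cont_g'] by blast
  obtain Kg where Kg: "0 < Kg" "\<And>y. y \<in> {-L..L} \<Longrightarrow> \<bar>g y\<bar> \<le> Kg"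
    using bounded_on_Icc[OF cont_g] by blast
  \<comment> \<open>Convergence at the single point 0 bounds the truncations there. This anchors the
    far part, for which only the variation in \<open>x\<close> is controlled.\<close>
  obtain W0 where W0: "\<And>n. \<bar>trunc_hilbert f (d n) (R n) 0\<bar> \<le> W0"
    using convergent_imp_Bseq[OF convergentI[OF H_lim[of 0]]] by (auto simp: Bseq_def)
  \<comment> \<open>The near parts at \<open>x\<close> and at 0 cost \<open>2 * K\<close> each, the
    value at 0 costs \<open>W0\<close>, and the variation of the far part costs
    \<open>12 * B * L\<close>.\<close>
  define W where "W = 4 * K + W0 + 12 * B * L"
  have W: "\<bar>trunc_hilbert f (d n) (R n) x\<bar> \<le> W" if x: "\<bar>x\<bar> \<le> L" for n x
  proof -
    have split: "trunc_hilbert f (d n) (R n) y = trunc_hilbert f (d n) 1 y + trunc_hilbert f 1 (R n) y" for y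
      by (rule trunc_hilbert_split) (auto simp: d_pos d_le R_ge)
    have near: "\<bar>trunc_hilbert f (d n) 1 y\<bar> \<le> 2 * K" if "\<bar>y\<bar> \<le> L" for y
      using trunc_hilbert_near_le[OF d_pos d_le that K(2)] .
    have "\<bar>trunc_hilbert f 1 (R n) x - trunc_hilbert f 1 (R n) 0\<bar> \<le> 12 * B * L"
      using trunc_hilbert_far_le[OF R_ge, of n x] x B_nonneg
      by (meson mult_left_mono mult_nonneg_nonneg order_trans zero_le_numeral)
    then show ?thesis
      using near[OF x] near[of 0] L_nonneg W0[of n] split[of x] split[of 0] unfolding W_def by simp
  qed
  have W_nonneg: "0 \<le> W" using W[of 0] L_nonneg by force
  have cont_T: "continuous_on S (trunc_hilbert f (d n) (R n))" for n S
    using DERIV_trunc_hilbert[OF d_pos less_imp_le[OF d_less]]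
    by (meson DERIV_isCont continuous_at_imp_continuous_on)
  define u where "u n x = trunc_hilbert f (d n) (R n) x * g' x" for n x
  have u_int: "u n integrable_on {-L..L}" for n
    unfolding u_def[abs_def] by (intro integrable_continuous_real continuous_intros cont_T)
  have u_le: "norm (u n x) \<le> W * K'" if x: "x \<in> {-L..L}" for n x
  proof -
    have "\<bar>trunc_hilbert f (d n) (R n) x\<bar> * \<bar>g' x\<bar> \<le> W * K'"
      using x by (intro mult_mono W K' W_nonneg) auto
    then show ?thesis by (simp add: u_def abs_mult)
  qed
  have u_lim: "(\<lambda>n. u n x) \<longlonglongrightarrow> pi * hilbert f x * g' x" for x
    unfolding u_def by (intro tendsto_intros H_lim)
  note u = dominated_convergence[OF u_int integrable_const_ivl[of "W * K'"] u_le u_lim]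
  define A where "A = integral {-L..L} (\<lambda>x. hilbert f x * g' x)"
  have A: "integral {-L..L} (\<lambda>x. pi * hilbert f x * g' x) = pi * A"
    by (simp add: A_def mult.assoc)
  show "(\<lambda>x. hilbert f x * g' x) integrable_on {-L..L}"
    using integrable_cmul[OF u(1), of "1 / pi"] by simp
  \<comment> \<open>These are the boundary terms of \<open>DERIV_trunc_hilbert\<close> weighted by
    \<open>g\<close>. The outer one vanishes because \<open>f\<close> is bounded, the inner one
    because \<open>f\<close> is differentiable.\<close>
  define v where "v n x = (sdiff f x (R n) / R n - sdiff f x (d n) / d n) * g x" for n x
  have v: "(\<lambda>n. integral {-L..L} (v n)) \<longlonglongrightarrow> integral {-L..L} (\<lambda>x. 0)"
  proof (rule dominated_convergence(2)[of v _ "\<lambda>_. (4 * B + 2 * K) * Kg"])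
    fix n x assume x: "x \<in> {-L..L}"
    then have xL: "\<bar>x\<bar> \<le> L" by auto
    have "\<bar>sdiff f x (R n) / R n\<bar> \<le> \<bar>sdiff f x (R n)\<bar> / 1"
      unfolding abs_divide using R_ge[of n] by (intro divide_left_mono) auto
    then have "\<bar>sdiff f x (R n) / R n - sdiff f x (d n) / d n\<bar> \<le> 4 * B + 2 * K"
      using sdiff_le[of x "R n"] sdiff_div_le[OF d_pos d_le xL K(2), of n] by linarith
    then have "\<bar>sdiff f x (R n) / R n - sdiff f x (d n) / d n\<bar> * \<bar>g x\<bar> \<le> (4 * B + 2 * K) * Kg"
      using x Kg B_nonneg K by (intro mult_mono) auto
    then show "norm (v n x) \<le> (4 * B + 2 * K) * Kg" by (simp add: v_def abs_mult)
  next
    fix x assume x: "x \<in> {-L..L}"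
    have "(\<lambda>n. 4 * B / R n) \<longlonglongrightarrow> 0"
      by (rule real_tendsto_divide_at_top[OF tendsto_const R_lim])
    then have "(\<lambda>n. sdiff f x (R n) / R n) \<longlonglongrightarrow> 0"
      by (rule Lim_null_comparison[rotated])
        (use R_ge sdiff_le in \<open>auto intro!: always_eventually divide_right_mono simp: R_def\<close>)
    moreover have "(\<lambda>n. sdiff f x (d n) / d n) \<longlonglongrightarrow> 0"
      by (rule sdiff_div_tendsto[OF d_lim]) (simp add: d_pos less_imp_neq[symmetric])
    ultimately show "(\<lambda>n. v n x) \<longlonglongrightarrow> 0"
      unfolding v_def by (intro tendsto_mult_left_zero tendsto_diff[where a = 0 and b = 0, simplified])
  qed (use d_pos R_ge in \<open>auto simp: v_def[abs_def] less_imp_neq[symmetric] R_def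
        intro!: integrable_continuous_real continuous_intros\<close>)
  \<comment> \<open>Integration by parts in \<open>x\<close>; the endpoint terms vanish because
    \<open>g\<close> is 0 at \<open>L\<close> and \<open>-L\<close>.\<close>
  have parts: "- integral {-L..L} (\<lambda>x. g x * quad_sdiff f (d n) (R n) x)
      = integral {-L..L} (u n) + integral {-L..L} (v n)" for n
  proof -
    let ?Q = "\<lambda>x. quad_sdiff f (d n) (R n) x"
    let ?T' = "\<lambda>x. sdiff f x (R n) / R n - sdiff f x (d n) / d n + ?Q x"
    have Rd: "R n \<noteq> 0" "d n \<noteq> 0" using R_ge[of n] d_pos[of n] by auto
    have v_int: "v n integrable_on {-L..L}"
      unfolding v_def[abs_def] by (intro integrable_continuous_real continuous_intros ballI Rd)
    have "((\<lambda>x. u n x + ?T' x * g x) has_integral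
        trunc_hilbert f (d n) (R n) L * g L - trunc_hilbert f (d n) (R n) (-L) * g (-L)) {-L..L}"
    proof (rule fundamental_theorem_of_calculus)
      fix x :: real
      have "((\<lambda>x. trunc_hilbert f (d n) (R n) x * g x) has_real_derivative u n x + ?T' x * g x) (at x)"
        using DERIV_mult[OF DERIV_trunc_hilbert[OF d_pos less_imp_le[OF d_less], of n x] deriv_g]
        by (simp add: u_def algebra_simps)
      then show "((\<lambda>x. trunc_hilbert f (d n) (R n) x * g x) has_vector_derivative
          u n x + ?T' x * g x) (at x within {-L..L})"
        by (simp add: has_real_derivative_iff_has_vector_derivative has_vector_derivative_at_within)
    qed (use L_nonneg in auto)
    then have "((\<lambda>x. u n x + ?T' x * g x) has_integral 0) {-L..L}"
      using L_nonneg by (simp add: g_outside)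
    from has_integral_diff[OF this has_integral_add[OF
        integrable_integral[OF u_int[of n]] integrable_integral[OF v_int]]]
    have "((\<lambda>x. g x * ?Q x) has_integral - (integral {-L..L} (u n) + integral {-L..L} (v n))) {-L..L}"
      by (simp add: v_def algebra_simps)
    then show ?thesis by (simp add: integral_unique)
  qed
  have lim: "(\<lambda>n. - integral {-L..L} (\<lambda>x. g x * quad_sdiff f (d n) (R n) x)) \<longlonglongrightarrow> pi * A"
    unfolding parts using tendsto_add[OF u(2) v] by (simp add: A)
  have "0 \<le> pi * A"
  proof (rule LIMSEQ_le_const[OF lim], intro exI[of _ 0] allI impI)
    fix n
    show "0 \<le> - integral {-L..L} (\<lambda>x. g x * quad_sdiff f (d n) (R n) x)"
      using dissipation_ge(2)[of "d n" "R n - d n" "R n"] d_pos d_less by simp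
  qed
  then show "0 \<le> integral {-L..L} (\<lambda>x. hilbert f x * g' x)"
    using pi_gt_zero unfolding A_def zero_le_mult_iff by linarith
  assume l: "0 < l"
  define D where "D = 2 * l * integral {-L..L} (\<lambda>x. (g x)\<^sup>2) - 2 * (integral {-L..L} g)\<^sup>2"
  have "(\<lambda>n. D / (d n + l)\<^sup>2) \<longlonglongrightarrow> D / (0 + l)\<^sup>2"
    using l by (intro tendsto_intros d_lim) auto
  then have "D / (0 + l)\<^sup>2 \<le> pi * A"
  proof (rule tendsto_le[OF _ lim, rotated])
    \<comment> \<open>The lower bound in \<open>dissipation_ge\<close> needs \<open>d n + l\<close>
      to be at most \<open>R n\<close>; as \<open>d n\<close> is at most 1, this holds for large
      \<open>n\<close>.\<close>
    have "eventually (\<lambda>n. 1 + l \<le> R n) sequentially"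
      using R_lim by (auto simp: filterlim_at_top)
    then show "\<forall>\<^sub>F n in sequentially.
        D / (d n + l)\<^sup>2 \<le> - integral {-L..L} (\<lambda>x. g x * quad_sdiff f (d n) (R n) x)"
    proof eventually_elim
      case (elim n)
      then show ?case
        using dissipation_ge(1)[OF d_pos l, of n "R n"] d_le[of n] by (simp add: D_def)
    qed
  qed auto
  then show "2 * (l * integral {-L..L} (\<lambda>x. (g x)\<^sup>2) - (integral {-L..L} g)\<^sup>2) / (pi * l\<^sup>2)
        \<le> integral {-L..L} (\<lambda>x. hilbert f x * g' x)"
    unfolding A_def[symmetric] D_def using l by (simp add: field_simps)
qed

end

section \<open>Smooth truncations\<close>

text \<open>A twice differentiable replacement for the positive part: the second derivative is needed to
  see the sign of the viscous term.\<close>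

definition smooth_pos :: "real \<Rightarrow> real \<Rightarrow> real" where
  "smooth_pos h v = (if v \<le> 0 then 0 else v - h * arctan (v / h))"

definition smooth_pos' :: "real \<Rightarrow> real \<Rightarrow> real" where
  "smooth_pos' h v = (if v \<le> 0 then 0 else v\<^sup>2 / (v\<^sup>2 + h\<^sup>2))"

definition smooth_pos'' :: "real \<Rightarrow> real \<Rightarrow> real" where
  "smooth_pos'' h v = (if v \<le> 0 then 0 else 2 * v * h\<^sup>2 / (v\<^sup>2 + h\<^sup>2)\<^sup>2)"

text \<open>At the junction the difference quotient of the glued function is dominated by that of
  \<open>F\<close>, which tends to \<open>F' 0 = 0\<close>.\<close>

lemma DERIV_zero_left:
  fixes F :: "real \<Rightarrow> real"
  assumes F: "\<And>v. (F has_real_derivative F' v) (at v)" and "F 0 = 0" "F' 0 = 0"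
  shows "((\<lambda>v. if v \<le> 0 then 0 else F v) has_real_derivative (if v \<le> 0 then 0 else F' v)) (at v)"
proof (cases v "0::real" rule: linorder_cases)
  case less
  have zero: "((\<lambda>v. 0::real) has_real_derivative 0) (at v)" by simp
  show ?thesis
    using less has_field_derivative_transform_within_open[OF zero open_lessThan[of 0]] by simp
next
  case greater
  then show ?thesis
    using has_field_derivative_transform_within_open[OF F[of v] open_greaterThan[of 0]] by simp
next
  case equal
  have "((\<lambda>h. F h / h) \<longlongrightarrow> 0) (at 0)"
    using F[of 0] assms by (simp add: DERIV_def)
  then have "((\<lambda>h. norm (F h / h)) \<longlongrightarrow> 0) (at 0)"
    by (rule tendsto_norm_zero)
  then have "((\<lambda>h. (if h \<le> 0 then 0 else F h) / h) \<longlongrightarrow> 0) (at 0)"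
    by (rule Lim_null_comparison[rotated]) 
      (auto intro!: always_eventually simp del: real_norm_def norm_divide abs_divide)
  then show ?thesis
    using equal by (simp add: DERIV_def cong: if_cong)
qed

lemma DERIV_smooth_pos:
  assumes "0 < h"
  shows "(smooth_pos h has_real_derivative smooth_pos' h v) (at v)"
  unfolding smooth_pos_def[abs_def] smooth_pos'_def
proof (rule DERIV_zero_left)
  fix v
  have *: "h\<^sup>2 + v\<^sup>2 \<noteq> 0" "h \<noteq> 0" using assms by (auto simp: sum_power2_eq_zero_iff)
  have "((\<lambda>v. v - h * arctan (v / h)) has_real_derivative
      1 - h * (inverse (1 + (v / h)\<^sup>2) * (1 / h))) (at v)"
    using assms by (auto intro!: derivative_eq_intros)
  moreover have "1 - h * (inverse (1 + (v / h)\<^sup>2) * (1 / h)) = v\<^sup>2 / (v\<^sup>2 + h\<^sup>2)"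
  proof -
    have "1 + (v / h)\<^sup>2 = (h\<^sup>2 + v\<^sup>2) / h\<^sup>2"
      using * by (simp add: power_divide add_divide_distrib)
    then have "1 - h * (inverse (1 + (v / h)\<^sup>2) * (1 / h)) = 1 - h\<^sup>2 / (h\<^sup>2 + v\<^sup>2)"
      using * by (simp add: inverse_eq_divide)
    also have "\<dots> = v\<^sup>2 / (v\<^sup>2 + h\<^sup>2)"
      using * by (simp add: diff_divide_eq_iff add.commute)
    finally show ?thesis .
  qed
  ultimately show "((\<lambda>v. v - h * arctan (v / h)) has_real_derivative v\<^sup>2 / (v\<^sup>2 + h\<^sup>2)) (at v)"
    by simp
qed auto

lemma DERIV_smooth_pos':
  assumes "0 < h"
  shows "(smooth_pos' h has_real_derivative smooth_pos'' h v) (at v)"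
  unfolding smooth_pos'_def[abs_def] smooth_pos''_def
proof (rule DERIV_zero_left)
  fix v
  have *: "v\<^sup>2 + h\<^sup>2 \<noteq> 0" using assms by (auto simp: sum_power2_eq_zero_iff)
  have "((\<lambda>v. v\<^sup>2 / (v\<^sup>2 + h\<^sup>2)) has_real_derivative
      (2 * v * (v\<^sup>2 + h\<^sup>2) - v\<^sup>2 * (2 * v)) / ((v\<^sup>2 + h\<^sup>2) * (v\<^sup>2 + h\<^sup>2))) (at v)"
    using * by (auto intro!: derivative_eq_intros)
  then show "((\<lambda>v. v\<^sup>2 / (v\<^sup>2 + h\<^sup>2)) has_real_derivative 2 * v * h\<^sup>2 / (v\<^sup>2 + h\<^sup>2)\<^sup>2) (at v)"
    by (simp add: power2_eq_square algebra_simps)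
qed auto

lemma smooth_pos'_bounds: "0 \<le> smooth_pos' h v" "smooth_pos' h v \<le> 1"
proof -
  have "v\<^sup>2 / (v\<^sup>2 + h\<^sup>2) \<le> 1" if "0 < v"
  proof -
    have "0 < v\<^sup>2 + h\<^sup>2" using that by (intro add_pos_nonneg) auto
    then show ?thesis by simp
  qed
  then show "smooth_pos' h v \<le> 1" "0 \<le> smooth_pos' h v"
    by (auto simp: smooth_pos'_def)
qed

lemma smooth_pos''_nonneg: "0 \<le> smooth_pos'' h v"
  by (simp add: smooth_pos''_def)

lemma continuous_smooth_pos': "0 < h \<Longrightarrow> continuous_on S (smooth_pos' h)"
  using DERIV_smooth_pos' by (meson DERIV_isCont continuous_at_imp_continuous_on)

lemma smooth_pos_nonneg:
  assumes "0 < h"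
  shows "0 \<le> smooth_pos h v"
proof (cases "v \<le> 0")
  case False
  have "smooth_pos h 0 \<le> smooth_pos h v"
    using DERIV_nonneg_imp_nondecreasing[of 0 v "smooth_pos h"] False
      DERIV_smooth_pos[OF assms] smooth_pos'_bounds(1) by force
  then show ?thesis by (simp add: smooth_pos_def)
qed (simp add: smooth_pos_def)

lemma smooth_pos_le:
  assumes "0 < h" "0 \<le> v"
  shows "smooth_pos h v \<le> v"
  using assms by (simp add: smooth_pos_def)

text \<open>The loss from smoothing is at most \<open>2 * h\<close> because \<open>arctan\<close>
  stays below \<open>pi / 2 < 2\<close>.\<close>

lemma smooth_pos_ge:
  assumes "0 < h"
  shows "v - 2 * h \<le> smooth_pos h v"
proof -
  have "arctan (v / h) \<le> 2"
    using arctan_ubound[of "v / h"] pi_less_4 by linarith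
  then show ?thesis
    using assms mult_left_mono[of "arctan (v / h)" 2 h] by (simp add: smooth_pos_def)
qed

text \<open>A Chebyshev-type gain. Where \<open>v\<close> exceeds \<open>h\<close>, smoothing at
  width \<open>h / 4\<close> loses at most \<open>h / 2\<close>, so the truncation is at least
  \<open>h / 2\<close> and one extra factor \<open>2 / h\<close> times it can be inserted. The width
  \<open>h'\<close> is free so that it can shrink along the iteration.\<close>

lemma smooth_pos_next_level:
  assumes h: "0 < h" "0 < h'"
  shows "smooth_pos h' (v - h) \<le> 2 / h * (smooth_pos (h / 4) v)\<^sup>2"
proof (cases "v \<le> h")
  case True
  then show ?thesis using h by (simp add: smooth_pos_def)
next
  case False
  let ?P = "smooth_pos (h / 4) v"
  have P: "v - h / 2 \<le> ?P" using smooth_pos_ge[of "h / 4" v] h by simp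
  have "smooth_pos h' (v - h) \<le> v - h"
    using False h by (intro smooth_pos_le) auto
  also have "\<dots> \<le> 1 * ?P" using P h by simp
  also have "\<dots> \<le> (2 / h * ?P) * ?P"
  proof (rule mult_right_mono)
    have "h \<le> 2 * ?P" using P False by simp
    then show "1 \<le> 2 / h * ?P" using h by (simp add: pos_le_divide_eq)
  qed (use h smooth_pos_nonneg in auto)
  finally show ?thesis by (simp add: power2_eq_square mult.assoc)
qed

section \<open>Continuity from local Hoelder bounds, and the second derivative test\<close>

lemma continuous_on_of_holder:
  fixes F :: "real \<Rightarrow> real \<Rightarrow> real"
  assumes \<alpha>: "0 < \<alpha>"
    and F: "\<And>R. \<exists>K. \<forall>t\<in>I. \<forall>s\<in>I. \<forall>x\<in>{-R..R}. \<forall>y\<in>{-R..R}.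
      \<bar>F t x - F s y\<bar> \<le> K * dist (t, x) (s, y) powr \<alpha>"
  shows "continuous_on (I \<times> UNIV) (\<lambda>(t, x). F t x)"
  unfolding continuous_on_def
proof
  fix p :: "real \<times> real" assume p: "p \<in> I \<times> UNIV"
  obtain s y where sy: "p = (s, y)" "s \<in> I" using p by auto
  define R where "R = \<bar>y\<bar> + 1"
  obtain K where "\<forall>t\<in>I. \<forall>s\<in>I. \<forall>x\<in>{-R..R}. \<forall>y\<in>{-R..R}.
      \<bar>F t x - F s y\<bar> \<le> K * dist (t, x) (s, y) powr \<alpha>"
    using F by blast
  moreover have "y \<in> {-R..R}" by (auto simp: R_def)
  ultimately have K: "\<bar>F t x - F s y\<bar> \<le> K * dist (t, x) (s, y) powr \<alpha>"
    if "t \<in> I" "x \<in> {-R..R}" for t x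
    using that sy by blast
  have "((\<lambda>q. dist q p) \<longlongrightarrow> dist p p) (at p within I \<times> UNIV)"
    by (intro tendsto_intros)
  then have "((\<lambda>q. dist q p powr \<alpha>) \<longlongrightarrow> 0) (at p within I \<times> UNIV)"
    using \<alpha> by (intro tendsto_zero_powrI[where b = \<alpha>]) auto
  then have lim: "((\<lambda>q. K * dist q p powr \<alpha>) \<longlongrightarrow> 0) (at p within I \<times> UNIV)"
    by (rule tendsto_mult_right_zero)
  have "\<forall>\<^sub>F q in at p within I \<times> UNIV. q \<in> I \<times> UNIV \<and> dist q p < 1"
    unfolding eventually_at by (intro exI[of _ 1]) auto
  then have "\<forall>\<^sub>F q in at p within I \<times> UNIV.
      norm ((\<lambda>(t, x). F t x) q - (\<lambda>(t, x). F t x) p) \<le> K * dist q p powr \<alpha>"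
  proof eventually_elim
    case (elim q)
    obtain t x where q: "q = (t, x)" by force
    have "\<bar>x - y\<bar> < 1"
      using elim dist_snd_le[of q p] by (simp add: q sy dist_real_def)
    then have "\<bar>x\<bar> \<le> R" unfolding R_def by linarith
    then have "x \<in> {-R..R}" by auto
    then show ?case
      using K[of t x] elim by (simp add: q sy)
  qed
  then have "((\<lambda>q. (\<lambda>(t, x). F t x) q - (\<lambda>(t, x). F t x) p) \<longlongrightarrow> 0) (at p within I \<times> UNIV)"
    using lim by (rule Lim_null_comparison)
  then show "((\<lambda>(t, x). F t x) \<longlongrightarrow> (\<lambda>(t, x). F t x) p) (at p within I \<times> UNIV)"
    by (simp only: LIM_zero_iff)
qed

text \<open>If \<open>l\<close> were negative, \<open>f'\<close>, which vanishes at the minimum,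
  would be negative just to its right, and \<open>f\<close> would drop below its minimum by the mean
  value theorem.\<close>

lemma second_deriv_nonneg_at_min:
  fixes f f' :: "real \<Rightarrow> real"
  assumes f: "\<And>x. (f has_real_derivative f' x) (at x)" and f': "(f' has_real_derivative l) (at x)"
    and min: "\<And>y. f x \<le> f y"
  shows "0 \<le> l"
proof -
  have 0: "f' x = 0"
    using DERIV_local_min[OF f, of 1 x] min by simp
  show ?thesis
  proof (rule ccontr)
    assume "\<not> 0 \<le> l"
    then obtain d where d: "0 < d" "\<And>h. 0 < h \<Longrightarrow> h < d \<Longrightarrow> f' (x + h) < f' x"
      using DERIV_neg_dec_right[OF f'] by auto
    obtain z where z: "x < z" "z < x + d / 2" "f (x + d / 2) - f x = (x + d / 2 - x) * f' z"
      using MVT2[of x "x + d / 2" f f'] f d(1) by auto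
    have "f' z < 0"
      using d(2)[of "z - x"] z d(1) 0 by simp
    then have "(x + d / 2 - x) * f' z < 0"
      using d(1) by (intro mult_pos_neg) auto
    then have "f (x + d / 2) - f x < 0"
      using z(3) by linarith
    then show False using min[of "x + d / 2"] by simp
  qed
qed

section \<open>Solutions of the transport equation\<close>

locale transport_solution =
  fixes \<epsilon> T :: real and \<theta> :: "real \<Rightarrow> real \<Rightarrow> real"
  assumes eps: "0 \<le> \<epsilon>" and T: "0 < T" and solution: "classical_solution \<epsilon> T \<theta>"
begin

lemma
  assumes "t \<in> {0..T}"
  shows DERIV_x: "(\<theta> t has_real_derivative deriv (\<theta> t) x) (at x)"
    and DERIV_t: "((\<lambda>s. \<theta> s x) has_real_derivative time_deriv T \<theta> t x) (at t within {0..T})"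
    and DERIV_xx: "0 < \<epsilon> \<Longrightarrow> (deriv (\<theta> t) has_real_derivative deriv (deriv (\<theta> t)) x) (at x)"
proof -
  have diff: "\<theta> t differentiable (at x)" "(\<lambda>s. \<theta> s x) differentiable (at t within {0..T})"
    "0 < \<epsilon> \<Longrightarrow> deriv (\<theta> t) differentiable (at x)"
    using assms solution unfolding classical_solution_def C1_holder_def by blast+
  show "(\<theta> t has_real_derivative deriv (\<theta> t) x) (at x)"
    using diff(1) by (simp only: DERIV_deriv_iff_real_differentiable)
  show "0 < \<epsilon> \<Longrightarrow> (deriv (\<theta> t) has_real_derivative deriv (deriv (\<theta> t)) x) (at x)"
    using diff(3) by (simp only: DERIV_deriv_iff_real_differentiable)
  show "((\<lambda>s. \<theta> s x) has_real_derivative time_deriv T \<theta> t x) (at t within {0..T})"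
    using diff(2) unfolding time_deriv_def has_real_derivative_iff_has_vector_derivative
    by (simp only: vector_derivative_works)
qed

lemma equation:
  "t \<in> {0..T} \<Longrightarrow>
    time_deriv T \<theta> t x + hilbert (\<theta> t) x * deriv (\<theta> t) x = \<epsilon> * deriv (deriv (\<theta> t)) x"
  and pv: "t \<in> {0..T} \<Longrightarrow> pv_integrable (\<lambda>y. \<theta> t y / (y - x)) x"
  using solution unfolding classical_solution_def by blast+

lemma
  shows cont_t: "continuous_on ({0..T} \<times> UNIV) (\<lambda>(t, x). time_deriv T \<theta> t x)"
    and cont_x: "continuous_on ({0..T} \<times> UNIV) (\<lambda>(t, x). deriv (\<theta> t) x)"
proof -
  obtain \<alpha> where \<alpha>: "0 < \<alpha>" "C1_holder \<alpha> T \<theta>"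
    using solution unfolding classical_solution_def by blast
  have H: "\<exists>K. \<forall>t\<in>{0..T}. \<forall>s\<in>{0..T}. \<forall>x\<in>{-R..R}. \<forall>y\<in>{-R..R}.
        \<bar>time_deriv T \<theta> t x - time_deriv T \<theta> s y\<bar> \<le> K * dist (t, x) (s, y) powr \<alpha> \<and>
        \<bar>deriv (\<theta> t) x - deriv (\<theta> s) y\<bar> \<le> K * dist (t, x) (s, y) powr \<alpha>" for R
    using \<alpha>(2) unfolding C1_holder_def by blast
  show "continuous_on ({0..T} \<times> UNIV) (\<lambda>(t, x). time_deriv T \<theta> t x)"
    by (rule continuous_on_of_holder[OF \<alpha>(1)]) (use H in blast)
  show "continuous_on ({0..T} \<times> UNIV) (\<lambda>(t, x). deriv (\<theta> t) x)"
    by (rule continuous_on_of_holder[OF \<alpha>(1)]) (use H in blast)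
qed

lemma bounded_on_strip:
  fixes h :: "real \<Rightarrow> real \<Rightarrow> real"
  assumes "continuous_on ({0..T} \<times> UNIV) (\<lambda>(t, x). h t x)"
  obtains K where "0 \<le> K" "\<And>t x. t \<in> {0..T} \<Longrightarrow> x \<in> {-R..R} \<Longrightarrow> \<bar>h t x\<bar> \<le> K"
proof -
  have "bounded ((\<lambda>(t, x). h t x) ` ({0..T} \<times> {-R..R}))"
    by (intro compact_imp_bounded compact_continuous_image compact_Times compact_Icc
        continuous_on_subset[OF assms]) auto
  then obtain K where K: "0 < K" "\<And>t x. t \<in> {0..T} \<Longrightarrow> x \<in> {-R..R} \<Longrightarrow> \<bar>h t x\<bar> \<le> K"
    unfolding bounded_pos by auto
  then show thesis using that[of K] by simp
qed

text \<open>Joint continuity is not postulated for \<open>\<theta>\<close> itself. Its two partial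
  derivatives are bounded on compact boxes, so it is Lipschitz there, that is, Hoelder with exponent
  1.\<close>

lemma cont: "continuous_on ({0..T} \<times> UNIV) (\<lambda>(t, x). \<theta> t x)"
proof (rule continuous_on_of_holder[of 1])
  fix R :: real
  obtain K1 where K1: "0 \<le> K1"
      "\<And>t x. t \<in> {0..T} \<Longrightarrow> x \<in> {-R..R} \<Longrightarrow> \<bar>time_deriv T \<theta> t x\<bar> \<le> K1"
    using bounded_on_strip[OF cont_t] by blast
  obtain K2 where K2: "0 \<le> K2"
      "\<And>t x. t \<in> {0..T} \<Longrightarrow> x \<in> {-R..R} \<Longrightarrow> \<bar>deriv (\<theta> t) x\<bar> \<le> K2"
    using bounded_on_strip[OF cont_x] by blast
  have "\<bar>\<theta> t x - \<theta> s y\<bar> \<le> (K1 + K2) * dist (t, x) (s, y) powr 1"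
    if ts: "t \<in> {0..T}" "s \<in> {0..T}" and xy: "x \<in> {-R..R}" "y \<in> {-R..R}" for t s x y
  proof -
    have "norm (\<theta> t x - \<theta> s x) \<le> K1 * norm (t - s)"
      by (rule field_differentiable_bound[of "{0..T}" _ "\<lambda>t. time_deriv T \<theta> t x"])
        (use ts xy K1 DERIV_t in auto)
    moreover have "norm (\<theta> s x - \<theta> s y) \<le> K2 * norm (x - y)"
      by (rule field_differentiable_bound[of "{-R..R}" _ "deriv (\<theta> s)"])
        (use ts xy K2 in \<open>auto intro: DERIV_subset[OF DERIV_x]\<close>)
    moreover have "K1 * \<bar>t - s\<bar> \<le> K1 * dist (t, x) (s, y)"
      using dist_fst_le[of "(t, x)" "(s, y)"] K1 by (intro mult_left_mono) (auto simp: dist_real_def)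
    moreover have "K2 * \<bar>x - y\<bar> \<le> K2 * dist (t, x) (s, y)"
      using dist_snd_le[of "(t, x)" "(s, y)"] K2 by (intro mult_left_mono) (auto simp: dist_real_def)
    ultimately show ?thesis
      by (simp add: distrib_right)
  qed
  then show "\<exists>K. \<forall>t\<in>{0..T}. \<forall>s\<in>{0..T}. \<forall>x\<in>{-R..R}. \<forall>y\<in>{-R..R}.
      \<bar>\<theta> t x - \<theta> s y\<bar> \<le> K * dist (t, x) (s, y) powr 1"
    by blast
qed simp

lemma decay:
  assumes "0 < e"
  obtains L where "0 \<le> L" "\<And>t x. t \<in> {0..T} \<Longrightarrow> L \<le> \<bar>x\<bar> \<Longrightarrow> \<bar>\<theta> t x\<bar> < e"
proof -
  have "\<forall>\<^sub>F x in at_infinity. \<forall>t\<in>{0..T}. dist (\<theta> t x) 0 < e"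
    using solution assms
    unfolding classical_solution_def decays_at_infinity_def uniform_limit_iff by blast
  then obtain b where b: "\<And>x t. b \<le> norm x \<Longrightarrow> t \<in> {0..T} \<Longrightarrow> dist (\<theta> t x) 0 < e"
    unfolding eventually_at_infinity by blast
  show thesis
    by (rule that[of "max b 0"]) (use b in auto)
qed

lemma bounded:
  obtains B where "\<And>t x. t \<in> {0..T} \<Longrightarrow> \<bar>\<theta> t x\<bar> \<le> B"
proof -
  obtain L where L: "\<And>t x. t \<in> {0..T} \<Longrightarrow> L \<le> \<bar>x\<bar> \<Longrightarrow> \<bar>\<theta> t x\<bar> < 1"
    using decay[of 1] by (metis zero_less_one)
  obtain K where K: "0 \<le> K" "\<And>t x. t \<in> {0..T} \<Longrightarrow> x \<in> {-L..L} \<Longrightarrow> \<bar>\<theta> t x\<bar> \<le> K"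
    using bounded_on_strip[OF cont] by blast
  show thesis
  proof (rule that)
    fix t x assume t: "t \<in> {0..T}"
    show "\<bar>\<theta> t x\<bar> \<le> max K 1"
      using L[OF t, of x] K(2)[OF t, of x] by (cases "L \<le> \<bar>x\<bar>") (auto simp: abs_if split: if_splits)
  qed
qed

lemma C1: obtains B where "\<And>t. t \<in> {0..T} \<Longrightarrow> C1_bounded (\<theta> t) (deriv (\<theta> t)) B"
proof -
  obtain B where B: "\<And>t x. t \<in> {0..T} \<Longrightarrow> \<bar>\<theta> t x\<bar> \<le> B"
    using bounded by blast
  have "C1_bounded (\<theta> t) (deriv (\<theta> t)) B" if t: "t \<in> {0..T}" for t
  proof
    have "continuous_on UNIV (\<lambda>x. (\<lambda>(t, x). deriv (\<theta> t) x) (t, x))"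
      by (rule continuous_on_compose2[OF cont_x]) (use t in \<open>auto intro!: continuous_intros\<close>)
    then show "continuous_on UNIV (deriv (\<theta> t))" by simp
  qed (use t DERIV_x B in auto)
  then show thesis using that by blast
qed

text \<open>At a negative minimum of \<open>\<theta> t x + \<eta> t\<close> the transport term vanishes, whatever the velocity.\<close>

lemma nonneg:
  assumes init: "\<And>x. 0 \<le> \<theta> 0 x" and t0: "t0 \<in> {0..T}"
  shows "0 \<le> \<theta> t0 x0"
proof (rule ccontr)
  assume neg: "\<not> 0 \<le> \<theta> t0 x0"
  define m where "m = - \<theta> t0 x0"
  \<comment> \<open>The tilt adds at most \<open>m / 2\<close> up to time \<open>T\<close>. Hence
    \<open>w\<close> is at most \<open>- m / 2\<close> at \<open>(t0, x0)\<close> but larger than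
    that for \<open>\<bar>x\<bar> \<ge> L\<close>, and a minimum over the box is global.\<close>
  define \<eta> where "\<eta> = m / (2 * T)"
  have m: "0 < m" using neg by (simp add: m_def)
  have \<eta>: "0 < \<eta>" using m T by (simp add: \<eta>_def)
  define w where "w t x = \<theta> t x + \<eta> * t" for t x
  have w0: "w t0 x0 \<le> - m / 2"
  proof -
    have "\<eta> * t0 \<le> \<eta> * T" using t0 \<eta> by (intro mult_left_mono) auto
    also have "\<dots> = m / 2" using T by (simp add: \<eta>_def)
    finally show ?thesis by (simp add: w_def m_def)
  qed
  obtain L where L: "0 \<le> L" "\<And>t x. t \<in> {0..T} \<Longrightarrow> L \<le> \<bar>x\<bar> \<Longrightarrow> \<bar>\<theta> t x\<bar> < m / 2"
    using decay[of "m / 2"] m by auto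
  have w_out: "- m / 2 < w t x" if "t \<in> {0..T}" "L \<le> \<bar>x\<bar>" for t x
  proof -
    have "0 \<le> \<eta> * t" using that \<eta> by simp
    then show ?thesis using L(2)[OF that] unfolding w_def by linarith
  qed
  have x0: "x0 \<in> {-L..L}"
    using w_out[OF t0, of x0] w0 by (cases "L \<le> \<bar>x0\<bar>") auto
  have "continuous_on ({0..T} \<times> {-L..L}) (\<lambda>p. (\<lambda>(t, x). \<theta> t x) p + \<eta> * fst p)"
    by (intro continuous_intros continuous_on_subset[OF cont]) auto
  then have "continuous_on ({0..T} \<times> {-L..L}) (\<lambda>p. w (fst p) (snd p))"
    by (simp add: w_def split_beta)
  from continuous_attains_inf[OF _ _ this]
  obtain p where p: "p \<in> {0..T} \<times> {-L..L}"
    and p_min: "\<And>q. q \<in> {0..T} \<times> {-L..L} \<Longrightarrow> w (fst p) (snd p) \<le> w (fst q) (snd q)"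
    using t0 x0 by (auto simp: compact_Times)
  define t1 x1 where "t1 = fst p" and "x1 = snd p"
  have 1: "t1 \<in> {0..T}" "x1 \<in> {-L..L}" using p by (auto simp: t1_def x1_def)
  have min_in: "w t1 x1 \<le> w t x" if "t \<in> {0..T}" "x \<in> {-L..L}" for t x
    using p_min[of "(t, x)"] that by (simp add: t1_def x1_def)
  have w1: "w t1 x1 \<le> - m / 2" using min_in[OF t0 x0] w0 by simp
  have min: "w t1 x1 \<le> w t x" if "t \<in> {0..T}" for t x
  proof (cases "L \<le> \<bar>x\<bar>")
    case True
    then show ?thesis using w_out[OF that] w1 by force
  next
    case False
    then have "x \<in> {-L..L}" by auto
    then show ?thesis by (rule min_in[OF that])
  qed
  \<comment> \<open>The initial data are nonnegative, so the minimum occurs at a positive time and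
    earlier times are available for comparison.\<close>
  have t1: "0 < t1"
    using 1 w1 m init[of x1] by (cases "t1 = 0") (auto simp: w_def)
  have min_x: "\<theta> t1 x1 \<le> \<theta> t1 y" for y
    using min[OF 1(1), of y] by (simp add: w_def)
  have x0: "deriv (\<theta> t1) x1 = 0"
    using DERIV_local_min[OF DERIV_x[OF 1(1)], of 1 x1] min_x by simp
  have "0 \<le> \<epsilon> * deriv (deriv (\<theta> t1)) x1"
    using second_deriv_nonneg_at_min[OF DERIV_x[OF 1(1)] DERIV_xx[OF 1(1)] min_x] eps
    by (cases "\<epsilon> = 0") auto
  \<comment> \<open>At the minimum the equation makes the time derivative of \<open>\<theta>\<close>
    equal to the viscous term, which is nonnegative. The tilt makes \<open>w\<close> strictly
    increasing in time there, so a slightly earlier value is smaller.\<close>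
  then have wt: "0 < time_deriv T \<theta> t1 x1 + \<eta>"
    using equation[OF 1(1), of x1] x0 \<eta> by simp
  have "((\<lambda>s. w s x1) has_real_derivative time_deriv T \<theta> t1 x1 + \<eta>) (at t1 within {0..T})"
    unfolding w_def by (auto intro!: derivative_eq_intros DERIV_t[OF 1(1)])
  then obtain d where d: "0 < d"
    "\<And>h. 0 < h \<Longrightarrow> t1 - h \<in> {0..T} \<Longrightarrow> h < d \<Longrightarrow> w (t1 - h) x1 < w t1 x1"
    using has_real_derivative_pos_inc_left[OF _ wt] by blast
  define h where "h = min (d / 2) t1"
  have "w (t1 - h) x1 < w t1 x1"
    by (rule d(2)) (use d(1) t1 1 in \<open>auto simp: h_def min_def\<close>)
  moreover have "w t1 x1 \<le> w (t1 - h) x1"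
    by (rule min) (use d(1) t1 1 in \<open>auto simp: h_def min_def\<close>)
  ultimately show False by simp
qed

end

section \<open>Energy decay and iteration\<close>

text \<open>Truncations at levels from \<open>c0\<close> on vanish outside \<open>[-L, L]\<close> at
  all times, so every energy is an integral over one fixed interval. Later \<open>c0\<close> is
  taken arbitrarily small.\<close>

locale transport_levels = transport_solution +
  fixes c0 L B :: real
  assumes L_nonneg: "0 \<le> L"
    and below: "\<And>t x. t \<in> {0..T} \<Longrightarrow> L \<le> \<bar>x\<bar> \<Longrightarrow> \<theta> t x \<le> c0"
    and C1_bounded: "\<And>t. t \<in> {0..T} \<Longrightarrow> C1_bounded (\<theta> t) (deriv (\<theta> t)) B"
begin

definition energy :: "real \<Rightarrow> real \<Rightarrow> real \<Rightarrow> real" where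
  "energy c h t = integral {-L..L} (\<lambda>x. smooth_pos h (\<theta> t x - c))"

lemma C1_truncation:
  assumes "t \<in> {0..T}" "c0 \<le> c" "0 < h"
  shows "C1_truncation (\<theta> t) (deriv (\<theta> t)) B
    (\<lambda>s. smooth_pos h (s - c)) (\<lambda>s. smooth_pos' h (s - c)) L"
proof (intro C1_truncation.intro C1_bounded C1_truncation_axioms.intro assms)
  show "((\<lambda>s. smooth_pos h (s - c)) has_real_derivative smooth_pos' h (s - c)) (at s)" for s
  proof -
    have "((\<lambda>s. s - c) has_real_derivative 1) (at s)"
      by (auto intro!: derivative_eq_intros)
    from DERIV_chain2[OF DERIV_smooth_pos[OF assms(3)] this] show ?thesis by simp
  qed
  show "continuous_on UNIV (\<lambda>s. smooth_pos' h (s - c))"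
    by (rule continuous_on_compose2[OF continuous_smooth_pos'[OF assms(3), of UNIV]])
      (auto intro!: continuous_intros)
  show "smooth_pos h (\<theta> t x - c) = 0" if "L \<le> \<bar>x\<bar>" for x
    using below[OF assms(1) that] assms(2) by (simp add: smooth_pos_def)
qed (use assms smooth_pos'_bounds smooth_pos_nonneg L_nonneg in auto)

lemma continuous_truncation:
  assumes "t \<in> {0..T}" "0 < h"
  shows "continuous_on S (\<lambda>x. smooth_pos h (\<theta> t x - c))"
proof (rule continuous_at_imp_continuous_on, rule ballI)
  fix x
  have "((\<lambda>x. smooth_pos h (\<theta> t x - c)) has_real_derivative
      smooth_pos' h (\<theta> t x - c) * deriv (\<theta> t) x) (at x)"
    by (intro DERIV_chain2[OF DERIV_smooth_pos[OF assms(2)]])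
      (auto intro!: derivative_eq_intros DERIV_x[OF assms(1)])
  then show "isCont (\<lambda>x. smooth_pos h (\<theta> t x - c)) x" by (rule DERIV_isCont)
qed

lemma DERIV_energy:
  assumes t: "t \<in> {0..T}" and h: "0 < h"
  shows "(energy c h has_real_derivative
    integral {-L..L} (\<lambda>x. smooth_pos' h (\<theta> t x - c) * time_deriv T \<theta> t x)) (at t within {0..T})"
  unfolding energy_def[abs_def] cbox_interval[symmetric]
proof (rule leibniz_rule_field_derivative)
  show "((\<lambda>s. smooth_pos h (\<theta> s x - c)) has_real_derivative
      smooth_pos' h (\<theta> s x - c) * time_deriv T \<theta> s x) (at s within cbox 0 T)"
    if "s \<in> cbox 0 T" for s x
    using that unfolding cbox_interval by (intro DERIV_chain2[OF DERIV_smooth_pos[OF h]])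
      (auto intro!: derivative_eq_intros DERIV_t)
  have "continuous_on (cbox 0 T \<times> cbox (- L) L)
      (\<lambda>p. smooth_pos' h ((\<lambda>(t, x). \<theta> t x) p - c) * (\<lambda>(t, x). time_deriv T \<theta> t x) p)"
    by (intro continuous_intros continuous_on_compose2[OF continuous_smooth_pos'[OF h, of UNIV]]
        continuous_on_subset[OF cont] continuous_on_subset[OF cont_t]) auto
  then show "continuous_on (cbox 0 T \<times> cbox (- L) L)
      (\<lambda>(t, x). smooth_pos' h (\<theta> t x - c) * time_deriv T \<theta> t x)"
    by (simp add: split_beta)
  fix s assume "s \<in> cbox 0 T"
  then show "(\<lambda>x. smooth_pos h (\<theta> s x - c)) integrable_on cbox (- L) L"
    using continuous_truncation[of s h] h by (auto intro: integrable_continuous_real)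
qed (use t in auto)

text \<open>The equation is multiplied by \<open>smooth_pos' h (\<theta> t x - c)\<close>. The
  viscous term is at most \<open>\<epsilon>\<close> times the exact derivative of this factor times
  \<open>deriv (\<theta> t)\<close>, because \<open>smooth_pos''\<close> is nonnegative; the exact
  derivative integrates to 0 since the factor vanishes at both endpoints.\<close>

lemma energy_deriv_le:
  assumes t: "t \<in> {0..T}" and c: "c0 \<le> c" and h: "0 < h"
  shows "integral {-L..L} (\<lambda>x. smooth_pos' h (\<theta> t x - c) * time_deriv T \<theta> t x)
    \<le> - integral {-L..L} (\<lambda>x. hilbert (\<theta> t) x * (smooth_pos' h (\<theta> t x - c) * deriv (\<theta> t) x))"
proof -
  interpret tr: C1_truncation "\<theta> t" "deriv (\<theta> t)" B
    "\<lambda>s. smooth_pos h (s - c)" "\<lambda>s. smooth_pos' h (s - c)" L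
    by (rule C1_truncation[OF t c h])
  let ?\<phi> = "\<lambda>x. smooth_pos' h (\<theta> t x - c)"
  let ?u = "\<lambda>x. hilbert (\<theta> t) x * (?\<phi> x * deriv (\<theta> t) x)"
  let ?D = "\<lambda>x. smooth_pos'' h (\<theta> t x - c) * deriv (\<theta> t) x * deriv (\<theta> t) x
      + ?\<phi> x * deriv (deriv (\<theta> t)) x"
  have u: "?u integrable_on {-L..L}"
    using tr.hilbert_flux_integrable[OF pv[OF t]] by (simp add: tr.g'_def)
  have "continuous_on {-L..L} (\<lambda>x. time_deriv T \<theta> t x)"
  proof -
    have "continuous_on {-L..L} (\<lambda>x. (\<lambda>(t, x). time_deriv T \<theta> t x) (t, x))"
      by (rule continuous_on_compose2[OF cont_t]) (use t in \<open>auto intro!: continuous_intros\<close>)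
    then show ?thesis by simp
  qed
  then have s: "(\<lambda>x. ?\<phi> x * time_deriv T \<theta> t x) integrable_on {-L..L}"
    by (intro integrable_continuous_real continuous_intros continuous_on_compose2[OF tr.cont_\<phi>]
        continuous_on_subset[OF tr.cont_f]) auto
  \<comment> \<open>The second derivative is not known to be integrable by itself. The comparison
    uses the exact derivative \<open>?D\<close>, whose gauge integral the fundamental theorem
    supplies. For \<open>\<epsilon> = 0\<close> the factor removes \<open>?D\<close> even if it
    contains a default value.\<close>
  have 0: "((\<lambda>x. \<epsilon> * ?D x) has_integral 0) {-L..L}"
  proof (cases "\<epsilon> = 0")
    case False
    then have e: "0 < \<epsilon>" using eps by simp
    have "(?D has_integral ?\<phi> L * deriv (\<theta> t) L - ?\<phi> (-L) * deriv (\<theta> t) (-L)) {-L..L}"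
    proof (rule fundamental_theorem_of_calculus)
      fix x
      have "((\<lambda>x. ?\<phi> x * deriv (\<theta> t) x) has_real_derivative
          smooth_pos'' h (\<theta> t x - c) * deriv (\<theta> t) x * deriv (\<theta> t) x
            + deriv (deriv (\<theta> t)) x * ?\<phi> x) (at x)"
        by (intro DERIV_mult DERIV_chain2[OF DERIV_smooth_pos'[OF h]] DERIV_xx[OF t e])
          (auto intro!: derivative_eq_intros DERIV_x[OF t])
      then show "((\<lambda>x. ?\<phi> x * deriv (\<theta> t) x) has_vector_derivative ?D x) (at x within {-L..L})"
        by (simp add: has_real_derivative_iff_has_vector_derivative has_vector_derivative_at_within
            mult.commute)
    qed (use L_nonneg in auto)
    moreover have "?\<phi> L = 0" "?\<phi> (-L) = 0"
      using below[OF t, of L] below[OF t, of "-L"] c L_nonneg by (auto simp: smooth_pos'_def)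
    ultimately show ?thesis
      using has_integral_mult_right[of ?D 0 _ \<epsilon>] by simp
  qed simp
  have "integral {-L..L} (\<lambda>x. ?\<phi> x * time_deriv T \<theta> t x) + integral {-L..L} ?u \<le> 0"
  proof (rule has_integral_le[OF has_integral_add[OF integrable_integral[OF s] integrable_integral[OF u]] 0])
    fix x
    have "?\<phi> x * time_deriv T \<theta> t x + ?u x = ?\<phi> x * (\<epsilon> * deriv (deriv (\<theta> t)) x)"
      unfolding equation[OF t, symmetric] by (simp add: algebra_simps)
    also have "\<dots> \<le> \<epsilon> * ?D x"
      using mult_nonneg_nonneg[OF smooth_pos''_nonneg[of h "\<theta> t x - c"] zero_le_square[of "deriv (\<theta> t) x"]] eps
      by (simp add: distrib_left mult.assoc mult.left_commute)
    finally show "?\<phi> x * time_deriv T \<theta> t x + ?u x \<le> \<epsilon> * ?D x" .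
  qed
  then show ?thesis by simp
qed

lemma energy_deriv_bounds:
  assumes t: "t \<in> {0..T}" and c: "c0 \<le> c" and h: "0 < h" and l: "0 < l"
    and E': "E' = integral {-L..L} (\<lambda>x. smooth_pos' h (\<theta> t x - c) * time_deriv T \<theta> t x)"
  shows "E' \<le> 0"
    and "2 * (l * integral {-L..L} (\<lambda>x. (smooth_pos h (\<theta> t x - c))\<^sup>2) - (energy c h t)\<^sup>2) / (pi * l\<^sup>2) \<le> - E'"
proof -
  interpret tr: C1_truncation "\<theta> t" "deriv (\<theta> t)" B
    "\<lambda>s. smooth_pos h (s - c)" "\<lambda>s. smooth_pos' h (s - c)" L
    by (rule C1_truncation[OF t c h])
  show "E' \<le> 0"
    using tr.hilbert_flux_nonneg[OF pv[OF t]] energy_deriv_le[OF t c h]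
    unfolding tr.g'_def E' by linarith
  show "2 * (l * integral {-L..L} (\<lambda>x. (smooth_pos h (\<theta> t x - c))\<^sup>2) - (energy c h t)\<^sup>2) / (pi * l\<^sup>2) \<le> - E'"
    using tr.hilbert_flux_ge[OF pv[OF t] l] energy_deriv_le[OF t c h]
    unfolding tr.g'_def tr.g_def[abs_def] E' energy_def by linarith
qed

lemma energy_nonneg: "t \<in> {0..T} \<Longrightarrow> 0 < h \<Longrightarrow> 0 \<le> energy c h t"
  unfolding energy_def
  by (intro integral_nonneg integrable_continuous_real continuous_truncation smooth_pos_nonneg)

text \<open>Selecting one time at which the decay rate equals its average replaces an integration of
  the dissipation in time.\<close>

lemma energy_mvt:
  assumes "a < b" "{a..b} \<subseteq> {0..T}" "0 < h"
  obtains t where "t \<in> {a<..<b}" "energy c h b - energy c h a =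
    integral {-L..L} (\<lambda>x. smooth_pos' h (\<theta> t x - c) * time_deriv T \<theta> t x) * (b - a)"
proof -
  let ?E' = "\<lambda>t. integral {-L..L} (\<lambda>x. smooth_pos' h (\<theta> t x - c) * time_deriv T \<theta> t x)"
  have "\<exists>t\<in>{a<..<b}. energy c h b - energy c h a = ?E' t * (b - a)"
  proof (rule mvt_simple[OF assms(1)])
    fix t assume "a \<le> t" "t \<le> b"
    then have "(energy c h has_real_derivative ?E' t) (at t within {0..T})"
      using assms by (intro DERIV_energy) auto
    then show "(energy c h has_derivative (*) (?E' t)) (at t within {a..b})"
      unfolding has_field_derivative_def using assms(2) by (rule has_derivative_subset)
  qed
  then show thesis using that by blast
qed

lemma energy_antimono:
  assumes "a \<le> b" "0 \<le> a" "b \<le> T" "c0 \<le> c" "0 < h"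
  shows "energy c h b \<le> energy c h a"
proof (cases "a = b")
  case False
  then have ab: "a < b" "{a..b} \<subseteq> {0..T}" using assms by auto
  obtain t where t: "t \<in> {a<..<b}" "energy c h b - energy c h a =
    integral {-L..L} (\<lambda>x. smooth_pos' h (\<theta> t x - c) * time_deriv T \<theta> t x) * (b - a)"
    using energy_mvt[OF ab assms(5)] by blast
  then have "energy c h b - energy c h a \<le> 0"
    using energy_deriv_bounds(1)[OF _ assms(4,5) zero_less_one refl, of t] ab
    by (auto intro: mult_nonpos_nonneg)
  then show ?thesis by simp
qed simp

text \<open>The scale \<open>l\<close> balances the dissipation rate \<open>M / \<tau>\<close> with the correlation term \<open>M\<^sup>2\<close>.\<close>

lemma energy_step:
  assumes ab: "0 \<le> a" "a < b" "b \<le> T" and c: "c0 \<le> c" and h: "0 < h" "0 < h'"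
    and M: "0 < M" "energy c (h / 4) a \<le> M" and hM: "9216 * M \<le> h\<^sup>2 * (b - a)"
  shows "energy (c + h) h' b \<le> M / 16"
proof -
  define \<tau> where "\<tau> = b - a"
  define l where "l = sqrt (\<tau> * M)"
  have \<tau>: "0 < \<tau>" using ab by (simp add: \<tau>_def)
  have l: "0 < l" "l\<^sup>2 = \<tau> * M" using \<tau> M by (auto simp: l_def)
  have h4: "0 < h / 4" using h by simp
  have ab': "{a..b} \<subseteq> {0..T}" using ab by auto
  define E' where "E' t = integral {-L..L} (\<lambda>x. smooth_pos' (h / 4) (\<theta> t x - c) * time_deriv T \<theta> t x)" for t
  obtain t where t: "t \<in> {a<..<b}" "energy c (h / 4) b - energy c (h / 4) a = E' t * \<tau>"
    using energy_mvt[OF ab(2) ab' h4] unfolding E'_def \<tau>_def by blast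
  have tT: "t \<in> {0..T}" using t ab by auto
  define G where "G = integral {-L..L} (\<lambda>x. (smooth_pos (h / 4) (\<theta> t x - c))\<^sup>2)"
  have "- E' t * \<tau> \<le> M"
    using t(2) M energy_nonneg[of b "h / 4" c] ab h4 by simp
  then have E'_le: "- E' t \<le> M / \<tau>"
    using \<tau> by (simp add: field_simps)
  have E_le: "(energy c (h / 4) t)\<^sup>2 \<le> M\<^sup>2"
    using energy_antimono[of a t c "h / 4"] energy_nonneg[OF tT h4] t M ab c h4
    by (intro power_mono) auto
  have "2 * (l * G - (energy c (h / 4) t)\<^sup>2) / (pi * l\<^sup>2) \<le> M / \<tau>"
    using energy_deriv_bounds(2)[OF tT c h4 l(1) refl] E'_le unfolding E'_def G_def by linarith
  then have "2 * (l * G - (energy c (h / 4) t)\<^sup>2) \<le> M / \<tau> * (pi * l\<^sup>2)"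
    using l(1) by (subst (asm) pos_divide_le_eq) auto
  \<comment> \<open>The choice of \<open>l\<close> turns the average decay rate into a multiple of
    \<open>M\<^sup>2\<close>. Together with the correlation term this gives \<open>4 + 2 = 6\<close>
    for \<open>2 * (l * G)\<close>.\<close>
  also have "\<dots> = pi * M\<^sup>2"
    unfolding l(2) using \<tau> by (simp add: power2_eq_square)
  also have "\<dots> \<le> 4 * M\<^sup>2"
    using pi_less_4 by (intro mult_right_mono) auto
  finally have lG: "l * G \<le> 3 * M\<^sup>2"
    using E_le by simp
  have "energy (c + h) h' b \<le> energy (c + h) h' t"
    using t ab c h by (intro energy_antimono) auto
  also have "\<dots> \<le> integral {-L..L} (\<lambda>x. 2 / h * (smooth_pos (h / 4) (\<theta> t x - c))\<^sup>2)"
    unfolding energy_def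
  proof (rule integral_le)
    show "(\<lambda>x. smooth_pos h' (\<theta> t x - (c + h))) integrable_on {-L..L}"
      by (intro integrable_continuous_real continuous_truncation tT h)
    show "(\<lambda>x. 2 / h * (smooth_pos (h / 4) (\<theta> t x - c))\<^sup>2) integrable_on {-L..L}"
      by (intro integrable_continuous_real continuous_intros continuous_truncation tT h4)
    show "smooth_pos h' (\<theta> t x - (c + h)) \<le> 2 / h * (smooth_pos (h / 4) (\<theta> t x - c))\<^sup>2" for x
      using smooth_pos_next_level[OF h, of "\<theta> t x - c"] by (simp add: algebra_simps)
  qed
  also have "\<dots> = 2 / h * G" by (simp add: G_def)
  also have "\<dots> \<le> M / 16"
  proof -
    \<comment> \<open>The target is \<open>32 * G \<le> h * M\<close>. Since \<open>l * G\<close> is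
      at most \<open>3 * M\<^sup>2\<close>, it suffices that \<open>h * l\<close> is at least
      \<open>96 * M\<close>, and \<open>9216 = 96\<^sup>2\<close>.\<close>
    have "(96 * M)\<^sup>2 \<le> (h * l)\<^sup>2"
      using mult_right_mono[OF hM, of M] M
      by (simp add: power_mult_distrib l(2) \<tau>_def[symmetric]) (simp add: power2_eq_square mult.assoc)
    then have "96 * M \<le> h * l"
      by (rule power2_le_imp_le) (use h l in auto)
    then have "96 * M * M \<le> h * l * M"
      using M by (intro mult_right_mono) auto
    moreover have "32 * (l * G) \<le> 96 * M * M"
      using lG by (simp only: power2_eq_square)
    ultimately have "l * (32 * G) \<le> l * (h * M)"
      by (simp add: algebra_simps)
    then have "32 * G \<le> h * M"
      using l(1) by simp
    then show ?thesis
      using h by (simp add: field_simps)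
  qed
  finally show ?thesis .
qed

text \<open>Level increments \<open>h / 2 ^ k\<close> add up to \<open>2 * h\<close> and time steps
  \<open>3 / 4 * T / 4 ^ k\<close> add up to \<open>T\<close>. The product of squared increment and
  time step scales like \<open>1 / 16 ^ k\<close>, as does the mass, so the condition of
  \<open>energy_step\<close> is the same at every stage; \<open>12288\<close> is
  \<open>4 / 3 * 9216\<close>.\<close>

lemma energy_iterate:
  assumes M: "0 < M" "energy c0 (h / 4) 0 \<le> M" and h: "0 < h" "12288 * M \<le> h\<^sup>2 * T"
  shows "energy (c0 + 2 * h * (1 - 1 / 2 ^ k)) (h / 2 ^ k / 4) (T * (1 - 1 / 4 ^ k)) \<le> M / 16 ^ k"
proof (induction k)
  case 0
  then show ?case using M by simp
next
  case (Suc k)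
  let ?c = "c0 + 2 * h * (1 - 1 / 2 ^ k)" and ?a = "T * (1 - 1 / 4 ^ k)" and ?b = "T * (1 - 1 / 4 ^ Suc k)"
  have pow: "(1::real) / 4 ^ Suc k < 1 / 4 ^ k" "(1::real) / 4 ^ k \<le> 1" "(1::real) / 2 ^ k \<le> 1"
    by (auto simp: field_simps)
  have ba: "?b - ?a = 3 / 4 * T / 4 ^ k"
    by (simp add: field_simps)
  have "energy (?c + h / 2 ^ k) (h / 2 ^ Suc k / 4) ?b \<le> M / 16 ^ k / 16"
  proof (rule energy_step[where a = ?a])
    show "?a < ?b" "0 \<le> ?a" "?b \<le> T" "c0 \<le> ?c"
      using T h pow by (auto simp: mult_left_le)
    have "(2 ^ k)\<^sup>2 = (4::real) ^ k" by (simp add: power2_eq_square flip: power_mult_distrib)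
    moreover have "(16::real) ^ k = 4 ^ k * 4 ^ k" by (simp flip: power_mult_distrib)
    ultimately have "(h / 2 ^ k)\<^sup>2 * (?b - ?a) = 3 / 4 * (h\<^sup>2 * T) / 16 ^ k"
      unfolding ba power_divide by simp
    moreover have "9216 * (M / 16 ^ k) \<le> 3 / 4 * (h\<^sup>2 * T) / 16 ^ k"
    proof -
      have "9216 * M \<le> 3 / 4 * (h\<^sup>2 * T)" using h(2) by linarith
      from divide_right_mono[OF this, of "16 ^ k"] show ?thesis by simp
    qed
    ultimately show "9216 * (M / 16 ^ k) \<le> (h / 2 ^ k)\<^sup>2 * (?b - ?a)" by simp
  qed (use M h Suc in auto)
  moreover have "?c + h / 2 ^ k = c0 + 2 * h * (1 - 1 / 2 ^ Suc k)"
    by (simp add: algebra_simps)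
  ultimately show ?case by simp
qed

lemma final_bound:
  assumes M: "0 < M" "energy c0 (h / 4) 0 \<le> M" and h: "0 < h" "12288 * M \<le> h\<^sup>2 * T"
    and L: "0 < L"
  shows "\<theta> T x \<le> c0 + 2 * h"
proof -
  have T': "T \<in> {0..T}" using T by simp
  let ?e = "\<lambda>x. max 0 (\<theta> T x - (c0 + 2 * h))"
  have "continuous_on UNIV (\<theta> T)"
    using C1_bounded.cont_f[OF C1_bounded[OF T']] .
  then have "continuous_on {-L..L} (\<theta> T)"
    by (rule continuous_on_subset) simp
  then have cont_e: "continuous_on {-L..L} ?e"
    by (intro continuous_intros)
  have le: "integral {-L..L} ?e \<le> M / 16 ^ k" for k
  proof -
    let ?c = "c0 + 2 * h * (1 - 1 / 2 ^ k)" and ?h = "h / 2 ^ k / 4"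
    have hk: "0 < ?h" using h by simp
    have "(1::real) / 2 ^ k \<le> 1" "(1::real) / 4 ^ k \<le> 1" by (auto simp: field_simps)
    then have c: "c0 \<le> ?c" and t: "0 \<le> T * (1 - 1 / 4 ^ k)" "T * (1 - 1 / 4 ^ k) \<le> T"
      using h T by (auto simp: mult_left_le)
    have "integral {-L..L} ?e \<le> energy ?c ?h T"
      unfolding energy_def
    proof (rule integral_le)
      fix x
      \<comment> \<open>The level \<open>?c\<close> lies \<open>2 * h / 2 ^ k\<close> below
        \<open>c0 + 2 * h\<close>, which more than covers the smoothing loss
        \<open>2 * ?h\<close>.\<close>
      have "\<theta> T x - (c0 + 2 * h) \<le> \<theta> T x - ?c - 2 * ?h"
        using h by (simp add: algebra_simps)
      then show "?e x \<le> smooth_pos ?h (\<theta> T x - ?c)"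
        using smooth_pos_ge[OF hk, of "\<theta> T x - ?c"] smooth_pos_nonneg[OF hk, of "\<theta> T x - ?c"]
        by linarith
    qed (intro integrable_continuous_real cont_e continuous_truncation T' hk)+
    also have "\<dots> \<le> energy ?c ?h (T * (1 - 1 / 4 ^ k))"
      using t c hk by (intro energy_antimono) auto
    also have "\<dots> \<le> M / 16 ^ k"
      by (rule energy_iterate[OF M h])
    finally show ?thesis .
  qed
  have "(\<lambda>k. M * (1 / 16) ^ k) \<longlonglongrightarrow> M * 0"
    by (intro tendsto_intros LIMSEQ_power_zero) auto
  then have "(\<lambda>k. M / 16 ^ k) \<longlonglongrightarrow> 0"
    by (simp add: power_one_over)
  then have "integral {-L..L} ?e \<le> 0"
    by (rule LIMSEQ_le_const) (use le in auto)
  moreover have "0 \<le> integral {-L..L} ?e"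
    by (intro integral_nonneg integrable_continuous_real cont_e) auto
  \<comment> \<open>A continuous nonnegative function with zero integral vanishes on the whole
    interval, which is nondegenerate because \<open>L\<close> is positive.\<close>
  ultimately have "\<forall>x\<in>{-L..L}. ?e x = 0"
    using integral_eq_0_iff[OF cont_e] L by auto
  then show ?thesis
  proof (cases "x \<in> {-L..L}")
    case True
    then show ?thesis using \<open>\<forall>x\<in>{-L..L}. ?e x = 0\<close> by fastforce
  next
    case False
    then have "L \<le> \<bar>x\<bar>" by auto
    then show ?thesis using below[OF T', of x] h by simp
  qed
qed

end

section \<open>Conclusion from arbitrary base level and mass\<close>

context transport_solution
begin

text \<open>The iteration needs a positive mass bound and a base level beyond which the solution
  stays small in space. It is run with \<open>m > M\<close> and base level \<open>e\<close>; then
  \<open>e\<close> and \<open>m - M\<close> tend to 0, which also covers zero initial mass.\<close>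

lemma upper_bound:
  assumes init: "\<And>x. 0 \<le> \<theta> 0 x" and int: "integrable lborel (\<theta> 0)"
  shows "\<theta> T x \<le> 224 * sqrt ((LINT x|lborel. \<theta> 0 x) / T)"
proof -
  define M where "M = (LINT x|lborel. \<theta> 0 x)"
  have "\<theta> T x \<le> 224 * sqrt (m / T)" if m: "M < m" for m
  proof (rule field_le_epsilon)
    fix e :: real assume e: "0 < e"
    have M0: "0 \<le> M" unfolding M_def using init by simp
    \<comment> \<open>The factor is chosen with \<open>112\<^sup>2 = 12544 \<ge> 12288\<close>; the
      final constant is \<open>2 * 112 = 224\<close>.\<close>
    define h where "h = 112 * sqrt (m / T)"
    have h: "0 < h" "12288 * m \<le> h\<^sup>2 * T"
      using m M0 T by (auto simp: h_def power_mult_distrib)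
    obtain L where L: "0 \<le> L" "\<And>t x. t \<in> {0..T} \<Longrightarrow> L \<le> \<bar>x\<bar> \<Longrightarrow> \<bar>\<theta> t x\<bar> < e"
      using decay[OF e] by blast
    obtain B where B: "\<And>t. t \<in> {0..T} \<Longrightarrow> C1_bounded (\<theta> t) (deriv (\<theta> t)) B"
      using C1 by blast
    \<comment> \<open>The radius is increased to \<open>L + 1\<close> because
      \<open>final_bound\<close> asks for a positive one.\<close>
    interpret lev: transport_levels \<epsilon> T \<theta> e "L + 1" B
    proof (intro transport_levels.intro transport_levels_axioms.intro transport_solution_axioms)
      fix t x assume "t \<in> {0..T}" "L + 1 \<le> \<bar>x\<bar>"
      then show "\<theta> t x \<le> e" using L(2)[of t x] by force
    qed (use L B in auto)
    have T0: "0 \<in> {0..T}" using T by simp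
    have int0: "\<theta> 0 integrable_on UNIV"
      using integrable_on_lborel[OF int] .
    have int0': "\<theta> 0 integrable_on {-(L+1)..L+1}"
      using integrable_on_subinterval[OF int0, of "-(L+1)" "L+1"] by simp
    have "lev.energy e (h / 4) 0 \<le> integral {-(L+1)..L+1} (\<theta> 0)"
      unfolding lev.energy_def
    proof (rule integral_le[OF _ int0'])
      show "(\<lambda>x. smooth_pos (h / 4) (\<theta> 0 x - e)) integrable_on {-(L+1)..L+1}"
        using h by (intro integrable_continuous_real lev.continuous_truncation T0) auto
      show "smooth_pos (h / 4) (\<theta> 0 x - e) \<le> \<theta> 0 x" for x
      proof (cases "\<theta> 0 x \<le> e")
        case True
        then show ?thesis using init[of x] by (simp add: smooth_pos_def)
      next
        case False
        then show ?thesis using smooth_pos_le[of "h / 4" "\<theta> 0 x - e"] h e by linarith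
      qed
    qed
    also have "\<dots> \<le> integral UNIV (\<theta> 0)"
      by (intro integral_subset_le int0 int0') (auto simp: init)
    also have "\<dots> = M"
      unfolding M_def by (rule integral_lborel[OF int])
    finally have "lev.energy e (h / 4) 0 \<le> m" using m by simp
    from lev.final_bound[OF _ this h]
    show "\<theta> T x \<le> 224 * sqrt (m / T) + e"
      using m M0 L by (simp add: h_def add.commute)
  qed
  then have "\<forall>\<^sub>F m in at_right M. \<theta> T x \<le> 224 * sqrt (m / T)"
    by (auto simp: eventually_at_filter)
  moreover have "((\<lambda>m. 224 * sqrt (m / T)) \<longlongrightarrow> 224 * sqrt (M / T)) (at_right M)"
    using T by (intro tendsto_intros) auto
  ultimately show ?thesis
    unfolding M_def[symmetric] by (intro tendsto_lowerbound) auto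
qed

end

theorem theorem5p4:
  "\<exists>C::real. C > 0 \<and>
     (\<forall>(\<epsilon>::real) (T::real) (\<theta>::real \<Rightarrow> real \<Rightarrow> real).
        \<epsilon> \<ge> 0 \<longrightarrow> T > 0 \<longrightarrow> classical_solution \<epsilon> T \<theta> \<longrightarrow>
        (\<forall>x. \<theta> 0 x \<ge> 0) \<longrightarrow> integrable lborel (\<theta> 0) \<longrightarrow>
        esssup lborel (\<lambda>x. ereal \<bar>\<theta> T x\<bar>)
          \<le> ereal (C * ((LINT x|lborel. \<bar>\<theta> 0 x\<bar>) / T) powr (1 / 2)))"
proof (intro exI[of _ 224] conjI allI impI)
  fix \<epsilon> T :: real and \<theta> :: "real \<Rightarrow> real \<Rightarrow> real"
  assume "\<epsilon> \<ge> 0" "T > 0" "classical_solution \<epsilon> T \<theta>"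
    and init: "\<forall>x. \<theta> 0 x \<ge> 0" "integrable lborel (\<theta> 0)"
  then interpret transport_solution \<epsilon> T \<theta> by unfold_locales
  have T': "T \<in> {0..T}" using T by simp
  have abs0: "(LINT x|lborel. \<bar>\<theta> 0 x\<bar>) = (LINT x|lborel. \<theta> 0 x)"
    using init by simp
  have "0 \<le> (LINT x|lborel. \<theta> 0 x) / T"
    using init T by simp
  \<comment> \<open>The minimum principle \<open>nonneg\<close> turns the one-sided bound into a
    bound on the absolute value.\<close>
  then have bound: "\<bar>\<theta> T x\<bar> \<le> 224 * ((LINT x|lborel. \<bar>\<theta> 0 x\<bar>) / T) powr (1 / 2)" for x
    using upper_bound[of x] nonneg[OF _ T', of x] init unfolding abs0
    by (simp add: powr_half_sqrt)
  \<comment> \<open>\<open>esssup\<close> is \<open>top\<close> on nonmeasurable functions, so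
    measurability is derived from continuity first.\<close>
  obtain B where "C1_bounded (\<theta> T) (deriv (\<theta> T)) B"
    using C1 T' by blast
  then have "\<theta> T \<in> borel_measurable borel"
    by (intro borel_measurable_continuous_onI C1_bounded.cont_f)
  then show "esssup lborel (\<lambda>x. ereal \<bar>\<theta> T x\<bar>)
      \<le> ereal (224 * ((LINT x|lborel. \<bar>\<theta> 0 x\<bar>) / T) powr (1 / 2))"
    using bound by (intro esssup_I) auto
qed simp

end
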